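(* Let $K$ be a field. For each ordinal $n\le\omega$ (that is, each non-negative integer $n$ and $n=\omega$), there exists a Leavitt path algebra $L_K(E)$ with Krull dimension $n$.
   Context: A graph $E=(E^0,E^1,r,s)$ consists of a set $E^0$ of vertices, a set $E^1$ of edges and maps $r,s:E^1\to E^0$ (range and source); no cardinality restrictions are imposed. A vertex $v$ is regular if $0<|s^{-1}(v)|<\infty$. The Leavitt path algebra $L_K(E)$ is the (not necessarily unital) $K$-algebra generated by pairwise orthogonal idempotents $v\in E^0$ and elements $e,e^*$ ($e\in E^1$) subject to: $s(e)e=e=er(e)$; $r(e)e^*=e^*=e^*s(e)$; $e^*e=r(e)$ and $e^*f=0$ for edges $e\ne f$; $v=\sum_{s(e)=v}ee^*$ for every regular vertex $v$. Ideals are two-sided. A proper ideal $P$ is prime if, for ideals $A,B$, $AB\subseteq P$ implies $A\subseteq P$ or $B\subseteq P$. A ring $R$ has Krull dimension $n$ ($n$ a non-negative integer) if $n$ is the supremum of the non-negative integers $k$ for which there is a chain of prime ideals $P_0\subsetneqq\cdots\subsetneqq P_k$ in $R$. For an infinite ordinal $\lambda$, $R$ has Krull dimension $\lambda$ if $\lambda$ is the supremum of the order types of all continuous well-ordered ascending chains of prime ideals in $R$ (continuous: at limit stages the chain takes unions). *)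

theory Defs
  imports
    "Graph_Theory.Digraph"
    "HOL-Library.Poly_Mapping"
    "HOL-Algebra.QuotRing"
    "HOL-Algebra.Ideal_Product"
begin

section \<open>The free algebra on the vertices, edges and ghost edges of a graph\<close>

text \<open>
  A graph \<open>E = (E\<^sup>0, E\<^sup>1, r, s)\<close> is a \<^locale>\<open>wf_digraph\<close>: \<open>E\<^sup>0\<close> is \<open>verts E\<close>, \<open>E\<^sup>1\<close> is \<open>arcs E\<close>,
  the source map is \<open>tail E\<close> and the range map is \<open>head E\<close>; then \<open>s\<^sup>-\<^sup>1(v)\<close> is \<open>out_arcs E v\<close>.
  Loops, multiple edges and infinite vertex and edge sets are allowed.
\<close>

datatype ('v, 'e) generator = Vertex 'v | Edge 'e | Ghost 'e

text \<open>
  Words under concatenation, written additively so that the convolution product of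
  \<^theory>\<open>HOL-Library.Poly_Mapping\<close> is the product of noncommutative polynomials.
\<close>

datatype 'g word = Word (letters: "'g list")

instantiation word :: (type) monoid_add
begin

definition zero_word :: "'g word"
  where "zero_word = Word []"

definition plus_word :: "'g word \<Rightarrow> 'g word \<Rightarrow> 'g word"
  where "plus_word u w = Word (letters u @ letters w)"

instance
  by standard (simp_all add: zero_word_def plus_word_def)

end

type_synonym ('v, 'e, 'k) ncpoly = "('v, 'e) generator word \<Rightarrow>\<^sub>0 'k"

definition generators :: "('v, 'e) pre_digraph \<Rightarrow> ('v, 'e) generator set"
  where "generators E = Vertex ` verts E \<union> Edge ` arcs E \<union> Ghost ` arcs E"

definition free_algebra :: "('v, 'e) pre_digraph \<Rightarrow> ('v, 'e, 'k::field) ncpoly ring"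
  where "free_algebra E =
    \<lparr>carrier = {p. \<forall>w \<in> Poly_Mapping.keys p. set (letters w) \<subseteq> generators E},
     mult = (*), one = 1, zero = 0, add = (+)\<rparr>"

text \<open>
  The free algebra without unit consists of the noncommutative polynomials without constant term.
  It is not unital, and the field \<open>one\<close> of the record is junk: it lies outside the carrier and
  is not used below.
\<close>

definition free_algebra_without_unit ::
    "('v, 'e) pre_digraph \<Rightarrow> ('v, 'e, 'k::field) ncpoly ring"
  where "free_algebra_without_unit E =
    (free_algebra E)\<lparr>carrier := {p \<in> carrier (free_algebra E). 0 \<notin> Poly_Mapping.keys p}\<rparr>"

lemma ring_free_algebra: "ring (free_algebra E :: ('v, 'e, 'k::field) ncpoly ring)"
proof -
  let ?R = "free_algebra E :: ('v, 'e, 'k) ncpoly ring"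
  have carrier_iff: "p \<in> carrier ?R \<longleftrightarrow>
      (\<forall>w \<in> Poly_Mapping.keys p. set (letters w) \<subseteq> generators E)" for p
    by (simp add: free_algebra_def)
  have add: "p + q \<in> carrier ?R" if "p \<in> carrier ?R" "q \<in> carrier ?R" for p q
    using that subsetD[OF keys_add[of p q]] unfolding carrier_iff by blast
  have mult: "p * q \<in> carrier ?R" if "p \<in> carrier ?R" "q \<in> carrier ?R" for p q
    unfolding carrier_iff
  proof
    fix w assume "w \<in> Poly_Mapping.keys (p * q)"
    then obtain u v where "w = u + v" "u \<in> Poly_Mapping.keys p" "v \<in> Poly_Mapping.keys q"
      using subsetD[OF keys_mult[of p q]] by blast
    then show "set (letters w) \<subseteq> generators E"
      using that unfolding carrier_iff by (simp add: plus_word_def)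
  qed
  have neg: "- p \<in> carrier ?R" if "p \<in> carrier ?R" for p
    using that unfolding carrier_iff by (simp add: in_keys_iff)
  have zero_one: "0 \<in> carrier ?R" "1 \<in> carrier ?R"
    by (simp_all add: carrier_iff zero_word_def)
  have ops: "x \<otimes>\<^bsub>?R\<^esub> y = x * y" "x \<oplus>\<^bsub>?R\<^esub> y = x + y" "\<zero>\<^bsub>?R\<^esub> = 0" "\<one>\<^bsub>?R\<^esub> = 1" for x y
    by (simp_all add: free_algebra_def)
  show ?thesis
  proof (rule ringI)
    show "abelian_group ?R"
    proof (rule abelian_groupI)
      fix x assume "x \<in> carrier ?R"
      then show "\<exists>y\<in>carrier ?R. y \<oplus>\<^bsub>?R\<^esub> x = \<zero>\<^bsub>?R\<^esub>"
        by (intro bexI[of _ "- x"] neg) (simp_all add: ops)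
    qed (simp_all only: ops add zero_one add_ac add_0 add_0_right)
    show "monoid ?R"
      by (rule monoidI) (simp_all only: ops mult zero_one mult.assoc mult_1_left mult_1_right)
  qed (simp_all only: ops distrib_left distrib_right)
qed


section \<open>Leavitt path algebras\<close>

definition gen :: "('v, 'e) generator \<Rightarrow> ('v, 'e, 'k::field) ncpoly"
  where "gen x = Poly_Mapping.single (Word [x]) 1"

abbreviation vx :: "'v \<Rightarrow> ('v, 'e, 'k::field) ncpoly"
  where "vx v \<equiv> gen (Vertex v)"

abbreviation ed :: "'e \<Rightarrow> ('v, 'e, 'k::field) ncpoly"
  where "ed e \<equiv> gen (Edge e)"

abbreviation gh :: "'e \<Rightarrow> ('v, 'e, 'k::field) ncpoly"
  where "gh e \<equiv> gen (Ghost e)"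

definition regular_vertex :: "('v, 'e) pre_digraph \<Rightarrow> 'v \<Rightarrow> bool"
  where "regular_vertex E v \<longleftrightarrow> v \<in> verts E \<and> out_arcs E v \<noteq> {} \<and> finite (out_arcs E v)"

definition leavitt_relators :: "('v, 'e) pre_digraph \<Rightarrow> ('v, 'e, 'k::field) ncpoly set"
  where "leavitt_relators E =
      {vx v * vx v - vx v |v. v \<in> verts E}
    \<union> {vx v * vx w |v w. v \<in> verts E \<and> w \<in> verts E \<and> v \<noteq> w}
    \<union> {vx (tail E e) * ed e - ed e |e. e \<in> arcs E}
    \<union> {ed e * vx (head E e) - ed e |e. e \<in> arcs E}
    \<union> {vx (head E e) * gh e - gh e |e. e \<in> arcs E}
    \<union> {gh e * vx (tail E e) - gh e |e. e \<in> arcs E}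
    \<union> {gh e * ed e - vx (head E e) |e. e \<in> arcs E}
    \<union> {gh e * ed f |e f. e \<in> arcs E \<and> f \<in> arcs E \<and> e \<noteq> f}
    \<union> {vx v - (\<Sum>e \<in> out_arcs E v. ed e * gh e) |v. regular_vertex E v}"

text \<open>
  Since the constants belong to \<^const>\<open>free_algebra\<close>, its ring ideals are \<open>K\<close>-subspaces. The ideal
  generated by the relators has no constant terms, and it is the algebra ideal that they generate
  in \<^const>\<open>free_algebra_without_unit\<close>.
\<close>

definition leavitt_path_algebra ::
    "('v, 'e) pre_digraph \<Rightarrow> ('v, 'e, 'k::field) ncpoly set ring"
  where "leavitt_path_algebra E =
    free_algebra_without_unit E Quot (Idl\<^bsub>free_algebra E\<^esub> (leavitt_relators E))"


section \<open>Prime ideals and Krull dimension of rings that need not have a unit\<close>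

text \<open>
  The locale \<^locale>\<open>ideal\<close> presupposes a unital ring; \<^const>\<open>additive_subgroup\<close> and
  \<^const>\<open>ideal_prod\<close> only involve the addition and the multiplication.
\<close>

definition two_sided_ideal :: "'a set \<Rightarrow> 'a ring \<Rightarrow> bool"
  where "two_sided_ideal I R \<longleftrightarrow> additive_subgroup I R \<and>
    (\<forall>a \<in> I. \<forall>x \<in> carrier R. x \<otimes>\<^bsub>R\<^esub> a \<in> I \<and> a \<otimes>\<^bsub>R\<^esub> x \<in> I)"

definition prime_ideal :: "'a set \<Rightarrow> 'a ring \<Rightarrow> bool"
  where "prime_ideal P R \<longleftrightarrow> two_sided_ideal P R \<and> P \<noteq> carrier R \<and>
    (\<forall>A B. two_sided_ideal A R \<and> two_sided_ideal B R \<and> ideal_prod R A B \<subseteq> P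
      \<longrightarrow> A \<subseteq> P \<or> B \<subseteq> P)"

definition has_prime_chain :: "'a ring \<Rightarrow> nat \<Rightarrow> bool"
  where "has_prime_chain R k \<longleftrightarrow>
    (\<exists>P :: nat \<Rightarrow> 'a set. (\<forall>i \<le> k. prime_ideal (P i) R) \<and> (\<forall>i < k. P i \<subset> P (Suc i)))"

text \<open>A ring without prime ideals is not given a Krull dimension.\<close>

definition has_krull_dimension :: "'a ring \<Rightarrow> nat \<Rightarrow> bool"
  where "has_krull_dimension R n \<longleftrightarrow>
    {k. has_prime_chain R k} \<noteq> {} \<and> bdd_above {k. has_prime_chain R k} \<and>
    Sup {k. has_prime_chain R k} = n"

text \<open>Ordinals are represented by well-order relations, compared by \<^const>\<open>ordLeq\<close>.\<close>

definition inclusion_on :: "'a set set \<Rightarrow> 'a set rel"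
  where "inclusion_on C = {(P, Q). P \<in> C \<and> Q \<in> C \<and> P \<subseteq> Q}"

definition limit_in :: "'a set set \<Rightarrow> 'a set \<Rightarrow> bool"
  where "limit_in C P \<longleftrightarrow> P \<in> C \<and> (\<exists>Q \<in> C. Q \<subset> P) \<and>
    (\<forall>Q \<in> C. Q \<subset> P \<longrightarrow> (\<exists>Q' \<in> C. Q \<subset> Q' \<and> Q' \<subset> P))"

definition continuous_prime_chain :: "'a ring \<Rightarrow> 'a set set \<Rightarrow> bool"
  where "continuous_prime_chain R C \<longleftrightarrow>
    (\<forall>P \<in> C. prime_ideal P R) \<and> Well_order (inclusion_on C) \<and>
    (\<forall>P. limit_in C P \<longrightarrow> P = \<Union>{Q \<in> C. Q \<subset> P})"

text \<open>
  Being the supremum is expressed as being the least upper bound. It suffices to compare \<open>r\<close>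
  with the upper bounds \<open>r'\<close> on the same type, because every ordinal smaller than \<open>r\<close> is the
  order type of an initial segment of \<open>r\<close>.
\<close>

definition has_infinite_krull_dimension :: "'a ring \<Rightarrow> 'o rel \<Rightarrow> bool"
  where "has_infinite_krull_dimension R r \<longleftrightarrow>
    Well_order r \<and> infinite (Field r) \<and>
    (\<forall>C. continuous_prime_chain R C \<longrightarrow> (inclusion_on C, r) \<in> ordLeq) \<and>
    (\<forall>r' :: 'o rel. Well_order r' \<and>
        (\<forall>C. continuous_prime_chain R C \<longrightarrow> (inclusion_on C, r') \<in> ordLeq)
      \<longrightarrow> (r, r') \<in> ordLeq)"

end

theory Submission
  imports Defs
begin

text \<open>
  Let \<open>E\<close> be a tower: its vertices form an initial segment \<open>S\<close> of the natural numbers, and each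
  vertex \<open>v + 1\<close> emits infinitely many edges, all of them to \<open>v\<close>. There are no regular vertices
  and no cycles, so every ideal is determined by the hereditary set of the vertices that it contains,
  and the proper ideals are the ideals \<open>I\<^sub>k\<close> generated by the vertices below \<open>k\<close>, for \<open>k\<close> in \<open>S\<close>.
  An ideal that is not contained in \<open>I\<^sub>k\<close> contains the idempotent \<open>k\<close>, so each \<open>I\<^sub>k\<close> is prime,
  and the prime ideals form a chain of order type \<open>S\<close>. When \<open>S\<close> is the set of all natural numbers,
  every element of the chain has finitely many predecessors.
\<close>

section \<open>Ideals of the free algebra and of its augmentation ideal\<close>

text \<open>Infinite emission does two jobs. At a regular vertex \<open>v + 1\<close> the last
  Leavitt relation would write \<open>v + 1\<close> as a finite sum of products \<open>e e*\<close>,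
  each of which factors through \<open>v\<close>; an ideal containing \<open>v\<close> would then
  contain every vertex above it. Without that relation an ideal can stop at any height. Moreover,
  for finitely many products \<open>p v q*\<close> some edge leaving \<open>v\<close> occurs in none
  of them, and this edge isolates a single product. Two obstacles shape the rest. The ring need not
  have a unit, and its ideals are not assumed to be subspaces, so scalars have to be absorbed into
  factors without constant term; the idempotent vertices provide such factors. Further, a
  presentation by generators and relations gives no lower bound on the algebra. That the vertex
  \<open>k\<close> survives modulo the vertices below it is read off from a concrete module, on
  which those vertices act as zero and \<open>k\<close> does not.\<close>

abbreviation free_carrier :: "('v, 'e) pre_digraph \<Rightarrow> ('v, 'e, 'k::field) ncpoly set"
  where "free_carrier E \<equiv> carrier (free_algebra E)"

definition augmentation_ideal :: "('v, 'e) pre_digraph \<Rightarrow> ('v, 'e, 'k::field) ncpoly set"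
  where "augmentation_ideal E = {p \<in> free_carrier E. 0 \<notin> Poly_Mapping.keys p}"

definition monom :: "'g list \<Rightarrow> ('g word \<Rightarrow>\<^sub>0 'k::field)"
  where "monom l = Poly_Mapping.single (Word l) 1"

definition const :: "'k::field \<Rightarrow> ('g word \<Rightarrow>\<^sub>0 'k)"
  where "const c = Poly_Mapping.single 0 c"

lemma monom_Nil [simp]: "monom [] = 1"
  by (simp add: monom_def zero_word_def[symmetric])

lemma monom_append: "monom (l @ m) = monom l * monom m"
  by (simp add: monom_def mult_single plus_word_def)

lemma gen_conv_monom: "gen g = monom [g]"
  by (simp add: gen_def monom_def)

lemma monom_Cons: "monom (g # l) = gen g * monom l"
  using monom_append[of "[g]" l] by (simp add: gen_conv_monom)

lemma single_conv_monom: "Poly_Mapping.single (Word l) c = const c * monom l"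
  by (simp add: monom_def const_def mult_single plus_word_def zero_word_def)

lemma const_add: "const (a + b) = const a + const b"
  by (simp add: const_def single_add)

lemma const_mult: "const (a * b) = const a * const b"
  by (simp add: const_def mult_single)

lemma const_1 [simp]: "const 1 = 1"
  by (simp add: const_def)

lemma const_0 [simp]: "const 0 = 0"
  by (simp add: const_def)

text \<open>The terms added are those of the fixed \<open>p\<close>, so a condition on the support
  of \<open>p\<close> is available at every step.\<close>

lemma ncpoly_induct [case_names zero add]:
  fixes p :: "'g word \<Rightarrow>\<^sub>0 'k::field"
  assumes zero: "P 0"
    and add: "\<And>w q. w \<in> Poly_Mapping.keys p \<Longrightarrow> P q \<Longrightarrow>
      P (Poly_Mapping.single w (Poly_Mapping.lookup p w) + q)"
  shows "P p"
proof -
  have "P (\<Sum>w\<in>A. Poly_Mapping.single w (Poly_Mapping.lookup p w))"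
    if "finite A" "A \<subseteq> Poly_Mapping.keys p" for A
    using that by (induction A rule: finite_induct) (auto simp: zero add)
  moreover have "(\<Sum>w\<in>Poly_Mapping.keys p. Poly_Mapping.single w (Poly_Mapping.lookup p w)) = p"
    by (rule poly_mapping_eqI) (auto simp: lookup_sum lookup_single when_def in_keys_iff)
  ultimately show ?thesis
    by (metis finite_keys order_refl)
qed

lemma const_commute: "const c * p = p * const c"
proof (induction p rule: ncpoly_induct)
  case (add w q)
  then show ?case
    by (simp add: distrib_left distrib_right)
      (simp add: const_def mult_single plus_word_def zero_word_def mult.commute)
qed simp

lemma mem_free_carrier:
  "p \<in> free_carrier E \<longleftrightarrow> (\<forall>w \<in> Poly_Mapping.keys p. set (letters w) \<subseteq> generators E)"
  by (simp add: free_algebra_def)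

lemma free_algebra_ops [simp]:
  "x \<otimes>\<^bsub>free_algebra E\<^esub> y = x * y" "x \<oplus>\<^bsub>free_algebra E\<^esub> y = x + y"
  "\<zero>\<^bsub>free_algebra E\<^esub> = 0" "\<one>\<^bsub>free_algebra E\<^esub> = 1"
  by (simp_all add: free_algebra_def)

lemma free_carrier_add [simp]:
  "p \<in> free_carrier E \<Longrightarrow> q \<in> free_carrier E \<Longrightarrow> p + q \<in> free_carrier E"
  using ring.ring_simprules(1)[OF ring_free_algebra, of p E q] by simp

lemma free_carrier_mult [simp]:
  "p \<in> free_carrier E \<Longrightarrow> q \<in> free_carrier E \<Longrightarrow> p * q \<in> free_carrier E"
  using ring.ring_simprules(5)[OF ring_free_algebra, of p E q] by simp

lemma free_carrier_uminus [simp]: "p \<in> free_carrier E \<Longrightarrow> - p \<in> free_carrier E"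
  by (simp add: mem_free_carrier in_keys_iff)

lemma free_carrier_diff [simp]:
  "p \<in> free_carrier E \<Longrightarrow> q \<in> free_carrier E \<Longrightarrow> p - q \<in> free_carrier E"
  using free_carrier_add[of p E "- q"] by simp

lemma free_carrier_0 [simp]: "0 \<in> free_carrier E"
  by (simp add: mem_free_carrier)

lemma free_carrier_const [simp]: "const c \<in> free_carrier E"
  by (auto simp: mem_free_carrier const_def zero_word_def split: if_splits)

lemma free_carrier_1 [simp]: "1 \<in> free_carrier E"
  using free_carrier_const[of 1] by simp

lemma free_carrier_monom [simp]: "set l \<subseteq> generators E \<Longrightarrow> monom l \<in> free_carrier E"
  by (auto simp: mem_free_carrier monom_def)

lemma free_carrier_gen [simp]: "g \<in> generators E \<Longrightarrow> gen g \<in> free_carrier E"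
  by (simp add: gen_conv_monom)

lemma zero_in_keys_mult:
  assumes "0 \<in> Poly_Mapping.keys (p * q :: 'g word \<Rightarrow>\<^sub>0 'k::field)"
  shows "0 \<in> Poly_Mapping.keys p \<and> 0 \<in> Poly_Mapping.keys q"
proof -
  obtain u v where "0 = u + v" "u \<in> Poly_Mapping.keys p" "v \<in> Poly_Mapping.keys q"
    using subsetD[OF keys_mult assms] by blast
  moreover from this have "u = 0" "v = 0"
    by (cases u; cases v; auto simp: plus_word_def zero_word_def)+
  ultimately show ?thesis by simp
qed

lemma augmentation_ideal_gen: "g \<in> generators E \<Longrightarrow> gen g \<in> augmentation_ideal E"
  by (simp add: augmentation_ideal_def) (simp add: gen_def zero_word_def)

text \<open>Negation and scalar multiplication are multiplications by constants, which the last
  clause covers.\<close>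

definition alg_ideal ::
    "('v, 'e) pre_digraph \<Rightarrow> ('v, 'e, 'k::field) ncpoly set \<Rightarrow> bool"
  where "alg_ideal E M \<longleftrightarrow> M \<subseteq> free_carrier E \<and> 0 \<in> M \<and> (\<forall>x\<in>M. \<forall>y\<in>M. x + y \<in> M) \<and>
    (\<forall>a\<in>free_carrier E. \<forall>x\<in>M. a * x \<in> M \<and> x * a \<in> M)"

lemma alg_ideal_uminus: "alg_ideal E M \<Longrightarrow> x \<in> M \<Longrightarrow> - x \<in> M"
  unfolding alg_ideal_def by (metis free_carrier_1 free_carrier_uminus mult_minus1)

lemma a_inv_free_algebra:
  assumes "x \<in> free_carrier E"
  shows "\<ominus>\<^bsub>free_algebra E\<^esub> x = - x"
proof -
  interpret ring "free_algebra E :: ('a, 'b, 'c) ncpoly ring"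
    by (rule ring_free_algebra)
  show ?thesis
    using minus_equality[of "- x" x] assms by simp
qed

lemma ideal_free_algebra_iff:
  "ideal M (free_algebra E :: ('v, 'e, 'k::field) ncpoly ring) \<longleftrightarrow> alg_ideal E M"
proof
  assume "ideal M (free_algebra E :: ('v, 'e, 'k) ncpoly ring)"
  then interpret ideal M "free_algebra E :: ('v, 'e, 'k) ncpoly ring" .
  show "alg_ideal E M"
    unfolding alg_ideal_def
    using a_subset I_l_closed I_r_closed additive_subgroup.a_closed[OF is_additive_subgroup]
      additive_subgroup.zero_closed[OF is_additive_subgroup] by simp
next
  assume M: "alg_ideal E M"
  show "ideal M (free_algebra E :: ('v, 'e, 'k) ncpoly ring)"
  proof (rule idealI)
    show "subgroup M (add_monoid (free_algebra E))"
    proof (rule subgroup.intro)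
      fix x assume "x \<in> M"
      moreover from this have "x \<in> free_carrier E"
        using M by (auto simp: alg_ideal_def)
      ultimately show "inv\<^bsub>add_monoid (free_algebra E)\<^esub> x \<in> M"
        using M alg_ideal_uminus a_inv_free_algebra[of x E] by (simp add: a_inv_def)
    qed (use M in \<open>auto simp: alg_ideal_def\<close>)
  qed (use M ring_free_algebra in \<open>auto simp: alg_ideal_def\<close>)
qed

lemma alg_ideal_genideal:
  assumes "G \<subseteq> free_carrier E"
  shows "alg_ideal E (Idl\<^bsub>free_algebra E\<^esub> G)"
  using ring.genideal_ideal[OF ring_free_algebra assms] by (simp add: ideal_free_algebra_iff)

lemma genideal_free_minimal:
  assumes "alg_ideal E M" "G \<subseteq> M"
  shows "Idl\<^bsub>free_algebra E\<^esub> G \<subseteq> M"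
  using ring.genideal_minimal[OF ring_free_algebra _ assms(2)] assms(1)
  by (simp add: ideal_free_algebra_iff)

lemma genideal_free_self: "G \<subseteq> free_carrier E \<Longrightarrow> G \<subseteq> Idl\<^bsub>free_algebra E\<^esub> G"
  by (rule ring.genideal_self[OF ring_free_algebra])

lemma alg_ideal_augmentation_ideal: "alg_ideal E (augmentation_ideal E)"
proof -
  have "0 \<notin> Poly_Mapping.keys (x + y)"
    if "0 \<notin> Poly_Mapping.keys x" "0 \<notin> Poly_Mapping.keys y" for x y :: "('a, 'b, 'c) ncpoly"
    using that subsetD[OF keys_add[of x y], of 0] by blast
  then show ?thesis
    by (auto simp: alg_ideal_def augmentation_ideal_def dest!: zero_in_keys_mult)
qed

text \<open>
  Ideals of the quotient of the augmentation ideal by \<open>N\<close> correspond to the subsets described here;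
  closure under multiplication by constants is not assumed.
\<close>

definition ideal_above ::
    "('v, 'e) pre_digraph \<Rightarrow> ('v, 'e, 'k::field) ncpoly set \<Rightarrow> ('v, 'e, 'k) ncpoly set \<Rightarrow> bool"
  where "ideal_above E N I \<longleftrightarrow> N \<subseteq> I \<and> I \<subseteq> augmentation_ideal E \<and>
    (\<forall>x\<in>I. \<forall>y\<in>I. x + y \<in> I) \<and> (\<forall>x\<in>I. - x \<in> I) \<and>
    (\<forall>a\<in>augmentation_ideal E. \<forall>x\<in>I. a * x \<in> I \<and> x * a \<in> I)"

section \<open>The correspondence between ideals of the quotient and ideals above
  \<open>N\<close>\<close>

locale augmentation_quotient =
  fixes E :: "('v, 'e) pre_digraph" and N :: "('v, 'e, 'k::field) ncpoly set"
  assumes alg_ideal_N: "alg_ideal E N" and N_subset: "N \<subseteq> augmentation_ideal E"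
begin

abbreviation F :: "('v, 'e, 'k) ncpoly set"
  where "F \<equiv> augmentation_ideal E"

abbreviation Q :: "('v, 'e, 'k) ncpoly set ring"
  where "Q \<equiv> free_algebra_without_unit E Quot N"

definition coset :: "('v, 'e, 'k) ncpoly \<Rightarrow> ('v, 'e, 'k) ncpoly set"
  where "coset x = {h + x |h. h \<in> N}"

definition preim :: "('v, 'e, 'k) ncpoly set set \<Rightarrow> ('v, 'e, 'k) ncpoly set"
  where "preim J = {x \<in> F. coset x \<in> J}"

lemma N_add: "x \<in> N \<Longrightarrow> y \<in> N \<Longrightarrow> x + y \<in> N"
  and N_0: "0 \<in> N"
  and N_mult_left: "a \<in> free_carrier E \<Longrightarrow> x \<in> N \<Longrightarrow> a * x \<in> N"
  and N_mult_right: "a \<in> free_carrier E \<Longrightarrow> x \<in> N \<Longrightarrow> x * a \<in> N"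
  and N_uminus: "x \<in> N \<Longrightarrow> - x \<in> N"
  using alg_ideal_N alg_ideal_uminus[OF alg_ideal_N] by (auto simp: alg_ideal_def)

lemma N_diff: "x \<in> N \<Longrightarrow> y \<in> N \<Longrightarrow> x - y \<in> N"
  using N_add[of x "- y"] N_uminus by simp

lemma F_carrier: "x \<in> F \<Longrightarrow> x \<in> free_carrier E"
  by (simp add: augmentation_ideal_def)

lemma F_add: "x \<in> F \<Longrightarrow> y \<in> F \<Longrightarrow> x + y \<in> F"
  and F_uminus: "x \<in> F \<Longrightarrow> - x \<in> F"
  and F_mult_left: "a \<in> free_carrier E \<Longrightarrow> x \<in> F \<Longrightarrow> a * x \<in> F"
  and F_mult_right: "a \<in> free_carrier E \<Longrightarrow> x \<in> F \<Longrightarrow> x * a \<in> F"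
  using alg_ideal_augmentation_ideal[of E] alg_ideal_uminus[OF alg_ideal_augmentation_ideal]
  by (auto simp: alg_ideal_def)

lemma coset_eq_iff: "coset x = coset y \<longleftrightarrow> x - y \<in> N"
proof
  assume "coset x = coset y"
  moreover have "x \<in> coset x"
    unfolding coset_def using N_0 by force
  ultimately obtain h where "h \<in> N" "x = h + y"
    by (auto simp: coset_def)
  then show "x - y \<in> N" by simp
next
  assume xy: "x - y \<in> N"
  have "h + x = (h + (x - y)) + y" "h + y = (h - (x - y)) + x" for h by simp_all
  then show "coset x = coset y"
    unfolding coset_def using N_add[OF _ xy] N_diff[OF _ xy] by fast
qed

lemma mem_coset: "a \<in> coset x \<longleftrightarrow> a - x \<in> N"
  unfolding coset_def by (force simp: algebra_simps)

lemma r_coset_Q: "N +>\<^bsub>free_algebra_without_unit E\<^esub> x = coset x"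
  by (auto simp: a_r_coset_def' free_algebra_without_unit_def coset_def)

lemma carrier_Q: "carrier Q = coset ` F"
  by (auto simp: FactRing_def A_RCOSETS_def' a_r_coset_def' free_algebra_without_unit_def
      augmentation_ideal_def coset_def)

lemma zero_Q: "\<zero>\<^bsub>Q\<^esub> = coset 0"
  by (auto simp: FactRing_def coset_def)

text \<open>The product in the factor ring is a union over all pairs of representatives. They all
  give the same coset, by \<open>ab - xy = (a - x) b + x (b - y)\<close>, so the union
  collapses.\<close>

lemma mult_Q:
  assumes "x \<in> F" "y \<in> F"
  shows "coset x \<otimes>\<^bsub>Q\<^esub> coset y = coset (x * y)"
proof -
  have "coset (a * b) = coset (x * y)" if "a - x \<in> N" "b - y \<in> N" for a b
  proof -
    have b: "b \<in> free_carrier E"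
      using that(2) N_subset F_carrier F_add[of "b - y" y] assms by auto
    have "a * b - x * y = (a - x) * b + x * (b - y)"
      by (simp add: algebra_simps)
    then show ?thesis
      unfolding coset_eq_iff using that b assms
      by (simp add: N_add N_mult_left N_mult_right F_carrier)
  qed
  moreover have "x \<in> coset x" "y \<in> coset y"
    by (simp_all add: mem_coset N_0)
  ultimately have "(\<Union>a\<in>coset x. \<Union>b\<in>coset y. coset (a * b)) = coset (x * y)"
    unfolding mem_coset[symmetric] by blast
  then show ?thesis
    by (simp add: FactRing_def rcoset_mult_def r_coset_Q) (simp add: free_algebra_without_unit_def)
qed

lemma add_Q:
  shows "coset x \<oplus>\<^bsub>Q\<^esub> coset y = coset (x + y)"
proof -
  have "(\<Union>a\<in>coset x. \<Union>b\<in>coset y. {a + b}) = coset (x + y)"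
  proof (intro equalityI subsetI)
    fix z assume "z \<in> coset (x + y)"
    then have "z = (z - y) + y" "z - y \<in> coset x" "y \<in> coset y"
      by (simp_all add: mem_coset N_0 algebra_simps)
    then show "z \<in> (\<Union>a\<in>coset x. \<Union>b\<in>coset y. {a + b})" by blast
  next
    fix z assume "z \<in> (\<Union>a\<in>coset x. \<Union>b\<in>coset y. {a + b})"
    then obtain a b where "z = a + b" "a - x \<in> N" "b - y \<in> N"
      by (auto simp: mem_coset)
    then show "z \<in> coset (x + y)"
      using N_add[of "a - x" "b - y"] by (simp add: mem_coset algebra_simps)
  qed
  then show ?thesis
    by (simp add: FactRing_def set_add_def' free_algebra_without_unit_def)
qed

text \<open>The inverse is evaluated from its definite description, because no group or ring locale
  has been established for \<open>Q\<close>, which in general has no unit.\<close>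

lemma inv_Q:
  assumes "x \<in> F"
  shows "inv\<^bsub>add_monoid Q\<^esub> (coset x) = coset (- x)"
proof -
  have "(THE y. y \<in> carrier Q \<and> coset x \<oplus>\<^bsub>Q\<^esub> y = \<zero>\<^bsub>Q\<^esub> \<and> y \<oplus>\<^bsub>Q\<^esub> coset x = \<zero>\<^bsub>Q\<^esub>) = coset (- x)"
  proof (rule the_equality)
    show "coset (- x) \<in> carrier Q \<and> coset x \<oplus>\<^bsub>Q\<^esub> coset (- x) = \<zero>\<^bsub>Q\<^esub> \<and>
        coset (- x) \<oplus>\<^bsub>Q\<^esub> coset x = \<zero>\<^bsub>Q\<^esub>"
      using assms F_uminus by (auto simp: carrier_Q zero_Q add_Q)
  next
    fix y assume y: "y \<in> carrier Q \<and> coset x \<oplus>\<^bsub>Q\<^esub> y = \<zero>\<^bsub>Q\<^esub> \<and> y \<oplus>\<^bsub>Q\<^esub> coset x = \<zero>\<^bsub>Q\<^esub>"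
    then obtain z where "y = coset z"
      by (auto simp: carrier_Q)
    with y show "y = coset (- x)"
      by (simp add: add_Q zero_Q coset_eq_iff add.commute)
  qed
  then show ?thesis
    by (simp add: m_inv_def)
qed

text \<open>Passing to preimages moves every question about ideals of \<open>Q\<close> to the free
  algebra, where polynomials can be computed with.\<close>

lemma ideal_above_preim:
  assumes "two_sided_ideal J Q"
  shows "ideal_above E N (preim J)" "J = coset ` preim J"
proof -
  from assms have sub: "subgroup J (add_monoid Q)"
    and mult: "\<And>a x. a \<in> J \<Longrightarrow> x \<in> carrier Q \<Longrightarrow> x \<otimes>\<^bsub>Q\<^esub> a \<in> J \<and> a \<otimes>\<^bsub>Q\<^esub> x \<in> J"
    by (auto simp: two_sided_ideal_def additive_subgroup_def)
  have J: "J \<subseteq> coset ` F"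
    using subgroup.subset[OF sub] by (simp add: carrier_Q)
  then show "J = coset ` preim J"
    by (auto simp: preim_def)
  have zero: "coset 0 \<in> J"
    using subgroup.one_closed[OF sub] by (simp add: zero_Q)
  show "ideal_above E N (preim J)"
    unfolding ideal_above_def
  proof (intro conjI ballI)
    show "N \<subseteq> preim J"
    proof
      fix x assume "x \<in> N"
      then have "coset x = coset 0" by (simp add: coset_eq_iff)
      with \<open>x \<in> N\<close> zero N_subset show "x \<in> preim J" by (auto simp: preim_def)
    qed
    show "preim J \<subseteq> F" by (auto simp: preim_def)
    show "x + y \<in> preim J" if "x \<in> preim J" "y \<in> preim J" for x y
      using that subgroup.m_closed[OF sub, of "coset x" "coset y"]
      by (simp add: preim_def add_Q F_add)
    show "- x \<in> preim J" if "x \<in> preim J" for x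
      using that subgroup.m_inv_closed[OF sub, of "coset x"] inv_Q[of x] F_uminus[of x]
      by (auto simp only: preim_def mem_Collect_eq)
    show "a * x \<in> preim J" "x * a \<in> preim J" if "x \<in> preim J" "a \<in> F" for a x
      using that mult[of "coset x" "coset a"]
      by (simp_all add: preim_def mult_Q F_mult_left F_mult_right F_carrier carrier_Q)
  qed
qed

lemma two_sided_ideal_coset:
  assumes "ideal_above E N I"
  shows "two_sided_ideal (coset ` I) Q"
proof -
  have I: "N \<subseteq> I" "I \<subseteq> F" "\<And>x y. x \<in> I \<Longrightarrow> y \<in> I \<Longrightarrow> x + y \<in> I" "\<And>x. x \<in> I \<Longrightarrow> - x \<in> I"
    "\<And>a x. a \<in> F \<Longrightarrow> x \<in> I \<Longrightarrow> a * x \<in> I \<and> x * a \<in> I"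
    using assms by (auto simp: ideal_above_def)
  have sub: "subgroup (coset ` I) (add_monoid Q)"
  proof (rule subgroup.intro)
    show "inv\<^bsub>add_monoid Q\<^esub> x \<in> coset ` I" if x: "x \<in> coset ` I" for x
    proof -
      obtain y where "x = coset y" "y \<in> I"
        using x by blast
      then show ?thesis
        using inv_Q[of y] I(2) I(4)[of y] by (simp only: subset_iff imageI)
    qed
    show "x \<otimes>\<^bsub>add_monoid Q\<^esub> y \<in> coset ` I" if xy: "x \<in> coset ` I" "y \<in> coset ` I" for x y
    proof -
      obtain a b where "x = coset a" "a \<in> I" "y = coset b" "b \<in> I"
        using xy by blast
      then show ?thesis
        using I(3)[of a b] by (simp add: add_Q)
    qed
    show "coset ` I \<subseteq> carrier (add_monoid Q)"
      using I(2) by (auto simp: carrier_Q)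
    show "\<one>\<^bsub>add_monoid Q\<^esub> \<in> coset ` I"
      using I(1) N_0 by (auto simp: zero_Q)
  qed
  have mult: "x \<otimes>\<^bsub>Q\<^esub> a \<in> coset ` I" "a \<otimes>\<^bsub>Q\<^esub> x \<in> coset ` I"
    if a: "a \<in> coset ` I" and x: "x \<in> carrier Q" for a x
  proof -
    obtain b y where "a = coset b" "b \<in> I" "x = coset y" "y \<in> F"
      using a x unfolding carrier_Q by blast
    moreover from this have "b \<in> F" using I(2) by blast
    ultimately show "x \<otimes>\<^bsub>Q\<^esub> a \<in> coset ` I" "a \<otimes>\<^bsub>Q\<^esub> x \<in> coset ` I"
      using I(5)[of y b] by (simp_all add: mult_Q)
  qed
  show ?thesis
    unfolding two_sided_ideal_def additive_subgroup_def
    by (intro conjI ballI sub mult)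
qed

text \<open>A set that contains \<open>N\<close> and is closed under addition is a union of cosets
  of \<open>N\<close>.\<close>

lemma coset_mem_image_iff:
  assumes "ideal_above E N I"
  shows "coset x \<in> coset ` I \<longleftrightarrow> x \<in> I"
proof
  assume "coset x \<in> coset ` I"
  then obtain y where y: "y \<in> I" "coset x = coset y"
    by blast
  then have "x - y \<in> I"
    using assms by (auto simp: coset_eq_iff ideal_above_def)
  then have "(x - y) + y \<in> I"
    using y(1) assms by (simp only: ideal_above_def)
  then show "x \<in> I" by simp
qed simp

end

section \<open>Towers of infinite emitters\<close>

text \<open>The pairing bijection labels the edges: \<open>prod_encode (i, m)\<close> is the
  \<open>m\<close>-th edge from \<open>i + 1\<close> to \<open>i\<close>.\<close>

definition target :: "nat \<Rightarrow> nat"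
  where "target e = fst (prod_decode e)"

definition tower :: "nat set \<Rightarrow> (nat, nat) pre_digraph"
  where "tower S =
    \<lparr>verts = S, arcs = {e. Suc (target e) \<in> S}, tail = \<lambda>e. Suc (target e), head = target\<rparr>"

lemma tower_simps [simp]:
  "verts (tower S) = S" "e \<in> arcs (tower S) \<longleftrightarrow> Suc (target e) \<in> S"
  "tail (tower S) e = Suc (target e)" "head (tower S) e = target e"
  by (simp_all add: tower_def)

lemma infinite_target: "infinite {e. target e = i}"
proof
  assume "finite {e. target e = i}"
  moreover have "range (\<lambda>m. prod_encode (i, m)) \<subseteq> {e. target e = i}"
    by (auto simp: target_def)
  ultimately have "finite (range (\<lambda>m. prod_encode (i, m)))"
    using finite_subset by blast
  moreover have "inj (\<lambda>m. prod_encode (i, m))"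
    by (auto intro: injI)
  ultimately show False
    using finite_imageD infinite_UNIV_nat by blast
qed

lemma no_regular_vertex_tower: "\<not> regular_vertex (tower S) v"
proof
  assume v: "regular_vertex (tower S) v"
  then obtain e where "Suc (target e) \<in> S" "v = Suc (target e)"
    by (auto simp: regular_vertex_def out_arcs_def)
  then have "out_arcs (tower S) v = {f. target f = target e}"
    by (auto simp: out_arcs_def)
  with v show False
    using infinite_target[of "target e"] by (simp add: regular_vertex_def)
qed

section \<open>Paths in a tower and their monomials\<close>

fun walk :: "nat set \<Rightarrow> nat \<Rightarrow> nat list \<Rightarrow> nat \<Rightarrow> bool"
  where
    "walk S u [] v \<longleftrightarrow> u = v \<and> v \<in> S"
  | "walk S u (e # p) v \<longleftrightarrow> u = Suc (target e) \<and> u \<in> S \<and> walk S (target e) p v"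

lemma walk_length: "walk S u p v \<Longrightarrow> u = v + length p"
  by (induction p arbitrary: u) auto

lemma walk_mem: "walk S u p v \<Longrightarrow> u \<in> S \<and> v \<in> S"
  by (induction p arbitrary: u) auto

text \<open>Edges descend by one, so every edge of a path to \<open>v\<close> starts strictly above
  \<open>v\<close>. In \<open>reduction\<close> this lets a vertex annihilate the edges of paths
  that end at it.\<close>

lemma walk_arcs: "walk S u p v \<Longrightarrow> e \<in> set p \<Longrightarrow> Suc (target e) \<in> S \<and> v \<le> target e"
proof (induction p arbitrary: u)
  case (Cons f p)
  then show ?case
    using walk_length[of S "target f" p v] by auto
qed simp

lemma walk_snoc: "walk S u p (Suc (target e)) \<Longrightarrow> target e \<in> S \<Longrightarrow> walk S u (p @ [e]) (target e)"
  by (induction p arbitrary: u) auto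

definition edges :: "nat list \<Rightarrow> (nat, nat, 'k::field) ncpoly"
  where "edges p = monom (map Edge p)"

text \<open>This is \<open>p*\<close>; the involution reverses products, hence
  \<open>rev\<close>.\<close>

definition ghosts :: "nat list \<Rightarrow> (nat, nat, 'k::field) ncpoly"
  where "ghosts p = monom (map Ghost (rev p))"

lemma edges_simps [simp]: "edges [] = 1" "edges (e # p) = ed e * edges p"
  by (simp_all add: edges_def monom_Cons)

lemma ghosts_simps [simp]: "ghosts [] = 1" "ghosts (e # p) = ghosts p * gh e"
  by (simp_all add: ghosts_def monom_append gen_conv_monom)

lemma ghosts_snoc: "ghosts (p @ [e]) = gh e * ghosts p"
  by (simp add: ghosts_def monom_Cons)

text \<open>The type token \<open>K\<close> fixes the field of scalars, which no other parameter
  mentions.\<close>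

locale tower_algebra =
  fixes S :: "nat set" and K :: "'k::field itself"
  assumes zero_S: "0 \<in> S" and Suc_S: "Suc i \<in> S \<Longrightarrow> i \<in> S"
begin

abbreviation E :: "(nat, nat) pre_digraph"
  where "E \<equiv> tower S"

abbreviation C :: "(nat, nat, 'k) ncpoly set"
  where "C \<equiv> free_carrier E"

definition N :: "(nat, nat, 'k) ncpoly set"
  where "N = Idl\<^bsub>free_algebra E\<^esub> (leavitt_relators E)"

lemma le_S: "i \<le> j \<Longrightarrow> j \<in> S \<Longrightarrow> i \<in> S"
  by (induction j) (use Suc_S le_Suc_eq in auto)

lemma generators_E [simp]:
  "Vertex v \<in> generators E \<longleftrightarrow> v \<in> S"
  "Edge e \<in> generators E \<longleftrightarrow> Suc (target e) \<in> S"
  "Ghost e \<in> generators E \<longleftrightarrow> Suc (target e) \<in> S"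
  by (auto simp: generators_def)

lemma relators_subset: "leavitt_relators E \<subseteq> (augmentation_ideal E :: (nat, nat, 'k) ncpoly set)"
proof -
  have aug: "alg_ideal E (augmentation_ideal E :: (nat, nat, 'k) ncpoly set)"
    by (rule alg_ideal_augmentation_ideal)
  have mult: "x * y \<in> augmentation_ideal E"
    if "x \<in> augmentation_ideal E" "y \<in> augmentation_ideal E" for x y :: "(nat, nat, 'k) ncpoly"
    using that aug by (auto simp: alg_ideal_def)
  have diff: "x - y \<in> augmentation_ideal E"
    if "x \<in> augmentation_ideal E" "y \<in> augmentation_ideal E" for x y :: "(nat, nat, 'k) ncpoly"
    using that aug alg_ideal_uminus[OF aug, of y]
    unfolding alg_ideal_def diff_conv_add_uminus by blast
  \<comment> \<open>The family of relators at regular vertices is empty; the others consist of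
    generators combined by products and differences.\<close>
  show ?thesis
    unfolding leavitt_relators_def
    using Suc_S
    by (auto simp: no_regular_vertex_tower intro!: mult diff augmentation_ideal_gen)
qed

sublocale augmentation_quotient E N
proof
  show "alg_ideal E N"
    unfolding N_def using relators_subset
    by (intro alg_ideal_genideal) (auto simp: augmentation_ideal_def)
  show "N \<subseteq> augmentation_ideal E"
    unfolding N_def by (rule genideal_free_minimal[OF alg_ideal_augmentation_ideal relators_subset])
qed

lemma leavitt_path_algebra_E: "leavitt_path_algebra E = Q"
  by (simp add: leavitt_path_algebra_def N_def)

section \<open>Calculating with the Leavitt relations modulo \<open>N\<close>\<close>

definition eqv :: "(nat, nat, 'k) ncpoly \<Rightarrow> (nat, nat, 'k) ncpoly \<Rightarrow> bool"  (infix \<open>\<approx>\<close> 50)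
  where "x \<approx> y \<longleftrightarrow> x - y \<in> N"

lemma eqv_refl [simp]: "x \<approx> x"
  by (simp add: eqv_def N_0)

lemma eqv_sym: "x \<approx> y \<Longrightarrow> y \<approx> x"
  unfolding eqv_def using N_uminus[of "x - y"] by simp

lemma eqv_trans [trans]: "x \<approx> y \<Longrightarrow> y \<approx> z \<Longrightarrow> x \<approx> z"
  unfolding eqv_def using N_add[of "x - y" "y - z"] by simp

lemma eqv_mem_N [trans]: "x \<approx> y \<Longrightarrow> y \<in> N \<Longrightarrow> x \<in> N"
  unfolding eqv_def using N_add[of "x - y" y] by simp

lemma eqv_mult_left: "a \<in> C \<Longrightarrow> x \<approx> y \<Longrightarrow> a * x \<approx> a * y"
  unfolding eqv_def using N_mult_left[of a "x - y"] by (simp add: algebra_simps)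

lemma eqv_mult_right: "a \<in> C \<Longrightarrow> x \<approx> y \<Longrightarrow> x * a \<approx> y * a"
  unfolding eqv_def using N_mult_right[of a "x - y"] by (simp add: algebra_simps)

lemma relators_N: "leavitt_relators E \<subseteq> N"
  unfolding N_def using relators_subset
  by (intro genideal_free_self) (auto simp: augmentation_ideal_def)

lemma
  assumes "v \<in> S"
  shows vx_vx: "vx v * vx v \<approx> vx v"
    and vx_vx_ne: "w \<in> S \<Longrightarrow> v \<noteq> w \<Longrightarrow> vx v * vx w \<in> N"
  using assms by (auto simp: eqv_def leavitt_relators_def intro!: subsetD[OF relators_N])

lemma
  assumes "Suc (target e) \<in> S"
  shows vx_ed: "vx (Suc (target e)) * ed e \<approx> ed e"
    and ed_vx: "ed e * vx (target e) \<approx> ed e"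
    and vx_gh: "vx (target e) * gh e \<approx> gh e"
    and gh_vx: "gh e * vx (Suc (target e)) \<approx> gh e"
    and gh_ed: "gh e * ed e \<approx> vx (target e)"
  unfolding eqv_def
proof -
  have e: "e \<in> arcs E" using assms by simp
  note mem = subsetD[OF relators_N, unfolded leavitt_relators_def]
  show "vx (Suc (target e)) * ed e - ed e \<in> N"
    by (rule mem) (use e in force)
  show "ed e * vx (target e) - ed e \<in> N"
    by (rule mem) (use e in force)
  show "vx (target e) * gh e - gh e \<in> N"
    by (rule mem) (use e in force)
  show "gh e * vx (Suc (target e)) - gh e \<in> N"
    by (rule mem) (use e in force)
  show "gh e * ed e - vx (target e) \<in> N"
    by (rule mem) (use e in force)
qed

lemma gh_ed_ne:
  assumes "Suc (target e) \<in> S" "Suc (target f) \<in> S" "e \<noteq> f"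
  shows "gh e * ed f \<in> N"
  using assms by (intro subsetD[OF relators_N]) (auto simp: leavitt_relators_def)

text \<open>Insert the source vertex, which \<open>e\<close> absorbs, and use that distinct vertices
  are orthogonal. The same insertion of an end vertex proves \<open>gh_vx_ne\<close> and
  \<open>ed_vx_ne\<close>.\<close>

lemma vx_ed_ne:
  assumes "Suc (target e) \<in> S" "v \<in> S" "v \<noteq> Suc (target e)"
  shows "vx v * ed e \<in> N"
proof -
  have "vx v * ed e \<approx> vx v * (vx (Suc (target e)) * ed e)"
    using assms by (intro eqv_mult_left eqv_sym[OF vx_ed]) auto
  also have "\<dots> = vx v * vx (Suc (target e)) * ed e"
    by (simp add: mult.assoc)
  also have "\<dots> \<in> N"
    using assms by (intro N_mult_right vx_vx_ne) auto
  finally show ?thesis .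
qed

lemma gh_vx_ne:
  assumes "Suc (target e) \<in> S" "v \<in> S" "v \<noteq> Suc (target e)"
  shows "gh e * vx v \<in> N"
proof -
  have "gh e * vx v \<approx> gh e * vx (Suc (target e)) * vx v"
    using assms by (intro eqv_mult_right eqv_sym[OF gh_vx]) auto
  also have "\<dots> = gh e * (vx (Suc (target e)) * vx v)"
    by (simp add: mult.assoc)
  also have "\<dots> \<in> N"
    using assms by (intro N_mult_left vx_vx_ne) auto
  finally show ?thesis .
qed

lemma ed_vx_ne:
  assumes "Suc (target e) \<in> S" "v \<in> S" "v \<noteq> target e"
  shows "ed e * vx v \<in> N"
proof -
  have "ed e * vx v \<approx> ed e * vx (target e) * vx v"
    using assms by (intro eqv_mult_right eqv_sym[OF ed_vx]) auto
  also have "\<dots> = ed e * (vx (target e) * vx v)"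
    by (simp add: mult.assoc)
  also have "\<dots> \<in> N"
    using assms Suc_S by (intro N_mult_left vx_vx_ne) auto
  finally show ?thesis .
qed

subsection \<open>Spanning by products of paths and ghost paths\<close>

text \<open>The end vertex is kept as a factor so that the empty path gives \<open>v\<close> and not
  the constant \<open>1\<close>, which lies outside the augmentation ideal.\<close>

definition path_mon :: "nat list \<Rightarrow> nat \<Rightarrow> (nat, nat, 'k) ncpoly"
  where "path_mon p v = edges p * vx v"

definition ghost_mon :: "nat \<Rightarrow> nat list \<Rightarrow> (nat, nat, 'k) ncpoly"
  where "ghost_mon v p = vx v * ghosts p"

lemma edges_C: "walk S u p v \<Longrightarrow> edges p \<in> C"
  by (auto simp: edges_def walk_arcs intro!: free_carrier_monom)

lemma ghosts_C: "walk S u p v \<Longrightarrow> ghosts p \<in> C"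
  by (auto simp: ghosts_def walk_arcs intro!: free_carrier_monom)

lemma path_mon_C: "walk S u p v \<Longrightarrow> path_mon p v \<in> C"
  using walk_mem edges_C by (simp add: path_mon_def)

lemma ghost_mon_C: "walk S u p v \<Longrightarrow> ghost_mon v p \<in> C"
  using walk_mem ghosts_C by (simp add: ghost_mon_def)

lemma vx_path_mon:
  assumes "walk S u p v"
  shows "vx u * path_mon p v \<approx> path_mon p v"
proof (cases p)
  case Nil
  then show ?thesis using assms by (simp add: path_mon_def vx_vx)
next
  case (Cons e q)
  then have e: "Suc (target e) \<in> S" "u = Suc (target e)" "walk S (target e) q v"
    using assms by auto
  have "vx u * ed e * path_mon q v \<approx> ed e * path_mon q v"
    using e by (intro eqv_mult_right path_mon_C) (auto intro: vx_ed)
  then show ?thesis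
    by (simp add: Cons path_mon_def mult.assoc)
qed

lemma vx_path_mon_ne:
  assumes "walk S u p v" "w \<in> S" "w \<noteq> u"
  shows "vx w * path_mon p v \<in> N"
proof -
  have u: "u \<in> S" using assms walk_mem by blast
  have "vx w * path_mon p v \<approx> vx w * (vx u * path_mon p v)"
    using assms by (intro eqv_mult_left eqv_sym[OF vx_path_mon]) auto
  also have "\<dots> = vx w * vx u * path_mon p v"
    by (simp add: mult.assoc)
  also have "\<dots> \<in> N"
    using assms u by (intro N_mult_right vx_vx_ne path_mon_C) auto
  finally show ?thesis .
qed

lemma ghost_mon_vx:
  assumes "walk S u p v"
  shows "ghost_mon v p * vx u \<approx> ghost_mon v p"
proof (cases p)
  case Nil
  then show ?thesis using assms by (simp add: ghost_mon_def vx_vx)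
next
  case (Cons e q)
  then have e: "Suc (target e) \<in> S" "u = Suc (target e)" "walk S (target e) q v"
    using assms by auto
  have "ghost_mon v q * (gh e * vx u) \<approx> ghost_mon v q * gh e"
    using e by (intro eqv_mult_left ghost_mon_C) (auto intro: gh_vx)
  then show ?thesis
    by (simp add: Cons ghost_mon_def mult.assoc)
qed

lemma ed_path_mon_ne:
  assumes "walk S u p v" "Suc (target e) \<in> S" "target e \<noteq> u"
  shows "ed e * path_mon p v \<in> N"
proof -
  have u: "u \<in> S" using assms walk_mem by blast
  have "ed e * path_mon p v \<approx> ed e * (vx u * path_mon p v)"
    using assms by (intro eqv_mult_left eqv_sym[OF vx_path_mon]) auto
  also have "\<dots> = ed e * vx u * path_mon p v"
    by (simp add: mult.assoc)
  also have "\<dots> \<in> N"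
    using assms u by (intro N_mult_right ed_vx_ne path_mon_C) auto
  finally show ?thesis .
qed

lemma gh_path_mon_Cons:
  assumes "walk S u (e # p) v"
  shows "gh e * path_mon (e # p) v \<approx> path_mon p v"
proof -
  have "gh e * path_mon (e # p) v = gh e * ed e * path_mon p v"
    by (simp add: path_mon_def mult.assoc)
  also have "\<dots> \<approx> vx (target e) * path_mon p v"
    using assms by (intro eqv_mult_right gh_ed path_mon_C) auto
  also have "\<dots> \<approx> path_mon p v"
    using assms by (intro vx_path_mon) auto
  finally show ?thesis .
qed

lemma gh_path_mon_Cons_ne:
  assumes "walk S u (f # p) v" "Suc (target e) \<in> S" "e \<noteq> f"
  shows "gh e * path_mon (f # p) v \<in> N"
proof -
  have "gh e * ed f * path_mon p v \<in> N"
    using assms by (intro N_mult_right gh_ed_ne path_mon_C) auto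
  then show ?thesis
    by (simp add: path_mon_def mult.assoc)
qed

lemma ghost_mon_ed_Cons:
  assumes "walk S u (e # p) v"
  shows "ghost_mon v (e # p) * ed e \<approx> ghost_mon v p"
proof -
  have "ghost_mon v (e # p) * ed e = ghost_mon v p * (gh e * ed e)"
    by (simp add: ghost_mon_def mult.assoc)
  also have "\<dots> \<approx> ghost_mon v p * vx (target e)"
    using assms by (intro eqv_mult_left gh_ed ghost_mon_C) auto
  also have "\<dots> \<approx> ghost_mon v p"
    using assms by (intro ghost_mon_vx) auto
  finally show ?thesis .
qed

lemma ghost_mon_ed_Cons_ne:
  assumes "walk S u (f # p) v" "Suc (target e) \<in> S" "e \<noteq> f"
  shows "ghost_mon v (f # p) * ed e \<in> N"
proof -
  have "ghost_mon v p * (gh f * ed e) \<in> N"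
    using assms by (intro N_mult_left gh_ed_ne ghost_mon_C) auto
  then show ?thesis
    by (simp add: ghost_mon_def mult.assoc)
qed

inductive_set path_span :: "(nat, nat, 'k) ncpoly set"
  where
    mem_N: "x \<in> N \<Longrightarrow> x \<in> path_span"
  | add_mon: "x \<in> path_span \<Longrightarrow> walk S u p v \<Longrightarrow> walk S w q v \<Longrightarrow>
      x + const c * (path_mon p v * ghost_mon v q) \<in> path_span"

lemma path_span_add_N: "x \<in> path_span \<Longrightarrow> n \<in> N \<Longrightarrow> x + n \<in> path_span"
proof (induction rule: path_span.induct)
  case (mem_N x)
  then show ?case by (intro path_span.mem_N N_add)
next
  case (add_mon x u p v w q c)
  then have "(x + n) + const c * (path_mon p v * ghost_mon v q) \<in> path_span"
    by (intro path_span.add_mon)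
  then show ?case by (simp add: algebra_simps)
qed

lemma path_span_add: "y \<in> path_span \<Longrightarrow> x \<in> path_span \<Longrightarrow> x + y \<in> path_span"
proof (induction rule: path_span.induct)
  case (mem_N y)
  then show ?case by (intro path_span_add_N)
next
  case (add_mon y u p v w q c)
  then have "(x + y) + const c * (path_mon p v * ghost_mon v q) \<in> path_span"
    by (intro path_span.add_mon)
  then show ?case by (simp add: algebra_simps)
qed

lemma path_span_eqv: "x \<approx> y \<Longrightarrow> y \<in> path_span \<Longrightarrow> x \<in> path_span"
  unfolding eqv_def using path_span_add_N[of y "x - y"] by simp

lemma path_span_const: "x \<in> path_span \<Longrightarrow> const c * x \<in> path_span"
proof (induction rule: path_span.induct)
  case (mem_N x)
  then show ?case by (intro path_span.mem_N N_mult_left free_carrier_const)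
next
  case (add_mon x u p v w q d)
  then have "const c * x + const (c * d) * (path_mon p v * ghost_mon v q) \<in> path_span"
    by (intro path_span.add_mon)
  then show ?case by (simp add: algebra_simps const_mult)
qed

lemma path_span_mon:
  assumes "walk S u p v" "walk S w q v"
  shows "path_mon p v * ghost_mon v q \<in> path_span"
  using path_span.add_mon[OF path_span.mem_N[OF N_0] assms, of 1] by simp

text \<open>Modulo \<open>N\<close> the generator either annihilates the product or yields another
  one of the same form. A vertex fixes \<open>p\<close>, an edge extends it, a ghost edge cancels
  its first edge; only when \<open>p\<close> is empty does a ghost edge reach the ghost
  part.\<close>

lemma gen_mon_path_span:
  assumes g: "g \<in> generators E" and p: "walk S u p v" and q: "walk S w q v"
  shows "gen g * (path_mon p v * ghost_mon v q) \<in> path_span"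
proof -
  note C = path_mon_C[OF p] ghost_mon_C[OF q]
  have in_N: ?thesis if "gen g * path_mon p v \<in> N"
    using path_span.mem_N[OF N_mult_right[OF C(2) that]] by (simp add: mult.assoc)
  have in_mon: ?thesis if "gen g * path_mon p v \<approx> path_mon p' v" "walk S u' p' v" for p' u'
    using path_span_eqv[OF eqv_mult_right[OF C(2) that(1)] path_span_mon[OF that(2) q]]
    by (simp add: mult.assoc)
  have v: "v \<in> S" using p walk_mem by blast
  show ?thesis
  proof (cases g)
    case (Vertex x)
    show ?thesis
    proof (cases "x = u")
      case True
      then show ?thesis using in_mon[OF _ p] vx_path_mon[OF p] Vertex by simp
    next
      case False
      then show ?thesis using in_N vx_path_mon_ne[OF p] g Vertex by simp
    qed
  next
    case (Edge e)
    show ?thesis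
    proof (cases "target e = u")
      case True
      then show ?thesis
        using in_mon[of "e # p" "Suc (target e)"] p g Edge by (simp add: path_mon_def mult.assoc)
    next
      case False
      then show ?thesis using in_N ed_path_mon_ne[OF p] g Edge by simp
    qed
  next
    case (Ghost e)
    then have e: "Suc (target e) \<in> S" using g by simp
    show ?thesis
    proof (cases p)
      case (Cons f p')
      show ?thesis
      proof (cases "e = f")
        case True
        have "gen g * path_mon p v \<approx> path_mon p' v"
          using gh_path_mon_Cons p True unfolding Cons Ghost by blast
        then show ?thesis
          using in_mon[of p' "target f"] p Cons by simp
      next
        case False
        then have "gen g * path_mon p v \<in> N"
          using gh_path_mon_Cons_ne[OF _ e False] p unfolding Cons Ghost by blast
        then show ?thesis by (rule in_N)
      qed
    next
      case Nil
      show ?thesis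
      proof (cases "v = Suc (target e)")
        case False
        then show ?thesis
          using in_N gh_vx_ne[OF e v] Ghost Nil by (simp add: path_mon_def)
      next
        case True
        \<comment> \<open>There is no edge left to cancel: \<open>e*\<close> joins the ghost part,
          and the common end vertex drops from \<open>v\<close> to \<open>target e\<close>.\<close>
        have t: "target e \<in> S" using e Suc_S by blast
        have gC: "ghosts q \<in> C" using q ghosts_C by blast
        have "gen g * (path_mon p v * ghost_mon v q) = gh e * vx v * vx v * ghosts q"
          by (simp add: Ghost Nil path_mon_def ghost_mon_def mult.assoc)
        also have "\<dots> \<approx> gh e * vx v * ghosts q"
          using True e v gC by (intro eqv_mult_right) (auto intro: gh_vx)
        also have "\<dots> \<approx> gh e * ghosts q"
          using True e v gC by (intro eqv_mult_right) (auto intro: gh_vx)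
        also have "\<dots> \<approx> vx (target e) * gh e * ghosts q"
          using e v gC by (intro eqv_mult_right) (auto intro: eqv_sym[OF vx_gh])
        also have "\<dots> \<approx> vx (target e) * vx (target e) * gh e * ghosts q"
          using e t gC by (intro eqv_mult_right eqv_sym[OF vx_vx]) auto
        also have "\<dots> = path_mon [] (target e) * ghost_mon (target e) (q @ [e])"
          by (simp add: path_mon_def ghost_mon_def ghosts_snoc mult.assoc)
        finally show ?thesis
        proof (rule path_span_eqv)
          show "path_mon [] (target e) * ghost_mon (target e) (q @ [e]) \<in> path_span"
            using q True t by (intro path_span_mon[of "target e" _ _ w] walk_snoc) auto
        qed
      qed
    qed
  qed
qed

lemma path_span_gen: "x \<in> path_span \<Longrightarrow> g \<in> generators E \<Longrightarrow> gen g * x \<in> path_span"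
proof (induction rule: path_span.induct)
  case (mem_N x)
  then show ?case by (intro path_span.mem_N N_mult_left free_carrier_gen)
next
  case (add_mon x u p v w q c)
  have "gen g * (x + const c * (path_mon p v * ghost_mon v q)) =
      gen g * x + const c * (gen g * (path_mon p v * ghost_mon v q))"
    by (simp add: distrib_left mult.assoc[symmetric] const_commute[of c "gen g"])
  also have "\<dots> \<in> path_span"
    using add_mon by (intro path_span_add path_span_const gen_mon_path_span)
  finally show ?case .
qed

lemma gen_path_span:
  assumes "g \<in> generators E"
  shows "gen g \<in> path_span"
proof (cases g)
  case (Vertex v)
  then have v: "v \<in> S" using assms by simp
  have "gen g \<approx> path_mon [] v * ghost_mon v []"
    using eqv_sym[OF vx_vx[OF v]] by (simp add: Vertex path_mon_def ghost_mon_def)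
  then show ?thesis
    by (rule path_span_eqv) (rule path_span_mon[of v _ _ v], use v in auto)
next
  case (Edge e)
  then have e: "Suc (target e) \<in> S" "target e \<in> S" using assms Suc_S by auto
  have "gen g \<approx> ed e * vx (target e)"
    using eqv_sym[OF ed_vx] e by (simp add: Edge)
  also have "\<dots> \<approx> ed e * (vx (target e) * vx (target e))"
    using e by (intro eqv_mult_left eqv_sym[OF vx_vx]) auto
  also have "\<dots> = path_mon [e] (target e) * ghost_mon (target e) []"
    by (simp add: path_mon_def ghost_mon_def mult.assoc)
  finally show ?thesis
    by (rule path_span_eqv)
      (rule path_span_mon[of "Suc (target e)" _ _ "target e"], use e in auto)
next
  case (Ghost e)
  then have e: "Suc (target e) \<in> S" "target e \<in> S" using assms Suc_S by auto
  have "gen g \<approx> vx (target e) * gh e"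
    using eqv_sym[OF vx_gh] e by (simp add: Ghost)
  also have "\<dots> \<approx> vx (target e) * vx (target e) * gh e"
    using e by (intro eqv_mult_right eqv_sym[OF vx_vx]) auto
  also have "\<dots> = path_mon [] (target e) * ghost_mon (target e) [e]"
    by (simp add: path_mon_def ghost_mon_def mult.assoc)
  finally show ?thesis
    by (rule path_span_eqv)
      (rule path_span_mon[of "target e" _ _ "Suc (target e)"], use e in auto)
qed

text \<open>Words grow at the left end, where \<open>path_span_gen\<close> applies. The induction
  starts at length one because the empty word is a constant.\<close>

lemma monom_path_span:
  assumes "l \<noteq> []" "set l \<subseteq> generators E"
  shows "monom l \<in> path_span"
  using assms
proof (induction l rule: list_nonempty_induct)
  case (single g)
  then show ?case by (simp add: gen_conv_monom[symmetric] gen_path_span)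
next
  case (cons g l)
  then show ?case by (simp add: monom_Cons path_span_gen)
qed

lemma F_path_span:
  assumes "x \<in> F"
  shows "x \<in> path_span"
proof (rule ncpoly_induct[of "\<lambda>y. y \<in> path_span"])
  show "0 \<in> path_span" by (rule path_span.mem_N[OF N_0])
next
  fix w q assume w: "w \<in> Poly_Mapping.keys x" and q: "q \<in> path_span"
  obtain l where l: "w = Word l" by (cases w)
  have "l \<noteq> []"
    using w l assms by (auto simp: augmentation_ideal_def zero_word_def)
  moreover have "set l \<subseteq> generators E"
    using w l assms unfolding augmentation_ideal_def mem_free_carrier by force
  ultimately show "Poly_Mapping.single w (Poly_Mapping.lookup x w) + q \<in> path_span"
    unfolding l single_conv_monom by (intro path_span_add path_span_const monom_path_span q)
qed

definition mon :: "nat list \<times> nat \<times> nat list \<Rightarrow> (nat, nat, 'k) ncpoly"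
  where "mon t = (case t of (p, v, q) \<Rightarrow> path_mon p v * ghost_mon v q)"

definition walk_pairs :: "(nat list \<times> nat \<times> nat list) set"
  where "walk_pairs = {(p, v, q). (\<exists>u. walk S u p v) \<and> (\<exists>w. walk S w q v)}"

text \<open>Repeated products are merged, so that \<open>T\<close> consists of distinct triples with
  one coefficient each, as \<open>reduction\<close> requires. A coefficient may become zero in the
  process.\<close>

lemma path_span_sum:
  assumes "x \<in> path_span"
  shows "\<exists>T c. finite T \<and> T \<subseteq> walk_pairs \<and> x \<approx> (\<Sum>t\<in>T. const (c t) * mon t)"
  using assms
proof (induction rule: path_span.induct)
  case (mem_N x)
  then show ?case by (intro exI[of _ "{}"]) (simp add: eqv_def)
next
  case (add_mon x u p v w q d)
  then obtain T c where T: "finite T" "T \<subseteq> walk_pairs"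
    and x: "x \<approx> (\<Sum>t\<in>T. const (c t) * mon t)" by blast
  let ?s = "(p, v, q)"
  \<comment> \<open>Outside \<open>T\<close> the values of \<open>c\<close> are arbitrary, hence the
    first test.\<close>
  define c' where "c' t = (if t \<in> T then c t else 0) + (if t = ?s then d else 0)" for t
  have "(\<Sum>t\<in>insert ?s T. const (c' t) * mon t) =
      (\<Sum>t\<in>insert ?s T. (if t \<in> T then const (c t) * mon t else 0) +
        (if t = ?s then const d * mon t else 0))"
    by (rule sum.cong) (auto simp: c'_def const_add distrib_right)
  also have "\<dots> = (\<Sum>t\<in>T. const (c t) * mon t) + const d * mon ?s"
    using T(1) by (simp add: sum.distrib sum.If_cases Int_absorb1 subset_insertI sum.delta)
  finally have "x + const d * mon ?s \<approx> (\<Sum>t\<in>insert ?s T. const (c' t) * mon t)"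
    using x by (simp add: eqv_def)
  moreover have "insert ?s T \<subseteq> walk_pairs"
    using T add_mon.hyps by (auto simp: walk_pairs_def)
  ultimately show ?case
    using T(1) by (intro exI[of _ "insert ?s T"] exI[of _ c']) (simp add: mon_def)
qed

subsection \<open>Reduction to a vertex\<close>

text \<open>Cancels \<open>p* p\<close> from the inside, one factor \<open>e* e\<close> at a
  time.\<close>

lemma ghosts_path_mon_same:
  assumes "walk S u p v" "x \<in> C"
  shows "x * ghosts p * path_mon p v \<approx> x * vx v"
  using assms
proof (induction p arbitrary: u)
  case Nil
  then show ?case by (simp add: path_mon_def)
next
  case (Cons e p)
  then have p: "walk S (target e) p v" by simp
  have "x * ghosts (e # p) * path_mon (e # p) v = x * ghosts p * (gh e * path_mon (e # p) v)"
    by (simp add: mult.assoc)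
  also have "\<dots> \<approx> x * ghosts p * path_mon p v"
    using Cons.prems ghosts_C[OF p] by (intro eqv_mult_left gh_path_mon_Cons) auto
  also have "\<dots> \<approx> x * vx v"
    using Cons p by simp
  finally show ?case .
qed

lemma ghost_mon_edges_same:
  assumes "walk S u p v" "x \<in> C"
  shows "ghost_mon v p * (edges p * x) \<approx> vx v * x"
  using assms
proof (induction p arbitrary: u)
  case Nil
  then show ?case by (simp add: ghost_mon_def)
next
  case (Cons e p)
  then have p: "walk S (target e) p v" by simp
  have "ghost_mon v (e # p) * (edges (e # p) * x) = ghost_mon v (e # p) * ed e * (edges p * x)"
    by (simp add: mult.assoc)
  also have "\<dots> \<approx> ghost_mon v p * (edges p * x)"
    using Cons.prems edges_C[OF p] by (intro eqv_mult_right ghost_mon_ed_Cons) auto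
  also have "\<dots> \<approx> vx v * x"
    using Cons p by simp
  finally show ?case .
qed

text \<open>Compare \<open>p\<close> and \<open>q\<close> edge by edge. The first difference gives
  zero by \<open>e* f = 0\<close>. If \<open>p\<close> runs out first, \<open>x\<close> kills the
  next edge of \<open>q\<close>; if both end together, then \<open>v \<noteq> v'\<close> and the
  vertices are orthogonal. The bound \<open>v' \<le> v\<close> settles the case that
  \<open>q\<close> runs out first.\<close>

lemma ghosts_path_mon_ne:
  assumes "walk S u p v" "walk S w q v'" "v' \<le> v" "(q, v') \<noteq> (p, v)" "x \<in> C"
    and x: "x * vx v \<approx> x" "\<And>e. e \<in> set q \<Longrightarrow> x * ed e \<in> N"
  shows "x * ghosts p * path_mon q v' \<in> N"
  using assms(1-5) x(2)
proof (induction p arbitrary: u w q)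
  case Nil
  show ?case
  proof (cases q)
    case (Cons e q')
    then have q': "walk S (target e) q' v'" using Nil.prems(2) by simp
    have "x * ed e * path_mon q' v' \<in> N"
      by (rule N_mult_right[OF path_mon_C[OF q']]) (use Nil.prems Cons in simp)
    then show ?thesis by (simp add: Cons path_mon_def mult.assoc)
  next
    assume q: "q = []"
    then have v: "v \<in> S" "v' \<in> S" "v \<noteq> v'" using Nil.prems by auto
    have "x * vx v' \<approx> x * vx v * vx v'"
      using v by (intro eqv_mult_right eqv_sym[OF x(1)]) auto
    also have "\<dots> = x * (vx v * vx v')" by (simp add: mult.assoc)
    also have "\<dots> \<in> N"
      by (rule N_mult_left[OF Nil.prems(5) vx_vx_ne[OF v]])
    finally show ?thesis by (simp add: q path_mon_def)
  qed
next
  case (Cons a p)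
  then have p: "walk S (target a) p v" and a: "Suc (target a) \<in> S" by auto
  have xp: "x * ghosts p \<in> C" using Cons.prems ghosts_C[OF p] by simp
  have "x * ghosts p * (gh a * path_mon q v') \<in> N"
  proof (cases q)
    \<comment> \<open>The rest of \<open>p\<close> descends to \<open>v\<close>, so its first edge
      \<open>a\<close> starts above \<open>v\<close>, hence above \<open>v'\<close>, and its ghost
      kills \<open>v'\<close>.\<close>
    case Nil
    then have "v' \<in> S" "v' < Suc (target a)"
      using Cons.prems walk_length[OF p] by auto
    then show ?thesis
      using gh_vx_ne[OF a] xp Nil by (auto simp: path_mon_def intro: N_mult_left)
  next
    case (Cons b q')
    show ?thesis
    proof (cases "a = b")
      case False
      have "walk S w (b # q') v'" using Cons.prems(2) unfolding Cons .
      then show ?thesis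
        using gh_path_mon_Cons_ne[OF _ a False] Cons xp by (auto intro: N_mult_left)
    next
      case True
      have w: "walk S w (a # q') v'" using Cons.prems(2) unfolding Cons True .
      have "x * ghosts p * (gh a * path_mon q v') \<approx> x * ghosts p * path_mon q' v'"
        using gh_path_mon_Cons[OF w] xp Cons True by (auto intro: eqv_mult_left)
      also have "\<dots> \<in> N"
      proof (rule Cons.IH[OF p _ Cons.prems(3) _ Cons.prems(5)])
        show "walk S (target a) q' v'" using w by simp
        show "(q', v') \<noteq> (p, v)" using Cons.prems(4) Cons True by simp
        show "x * ed e \<in> N" if "e \<in> set q'" for e
          using that Cons.prems(6) Cons by simp
      qed
      finally show ?thesis .
    qed
  qed
  then show ?case by (simp add: mult.assoc)
qed

text \<open>Mirror image of \<open>ghosts_path_mon_ne\<close>, meant for terms that agree with the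
  chosen one in \<open>(p, v)\<close> and hence differ from it in \<open>q\<close>.\<close>

lemma ghost_mon_edges_ne:
  assumes "walk S u p v" "walk S w q v'" "v' \<le> v" "q \<noteq> p" "x \<in> C"
    and "\<And>e. e \<in> set q \<Longrightarrow> gh e * x \<in> N"
  shows "ghost_mon v' q * (edges p * x) \<in> N"
  using assms
proof (induction p arbitrary: u w q)
  case Nil
  then obtain e q' where q: "q = e # q'" by (cases q) auto
  have q': "walk S (target e) q' v'" using Nil.prems(2) q by simp
  have "ghost_mon v' q' * (gh e * x) \<in> N"
    by (rule N_mult_left[OF ghost_mon_C[OF q']]) (use Nil.prems q in simp)
  then show ?case by (simp add: q ghost_mon_def mult.assoc)
next
  case (Cons a p)
  then have p: "walk S (target a) p v" and a: "Suc (target a) \<in> S" by auto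
  have px: "edges p * x \<in> C" using Cons.prems edges_C[OF p] by simp
  have "ghost_mon v' q * ed a * (edges p * x) \<in> N"
  proof (cases q)
    case Nil
    then have "v' \<in> S" "v' < Suc (target a)"
      using Cons.prems walk_length[OF p] by auto
    then show ?thesis
      using vx_ed_ne[OF a] px Nil by (auto simp: ghost_mon_def intro: N_mult_right)
  next
    case (Cons b q')
    show ?thesis
    proof (cases "a = b")
      case False
      have "walk S w (b # q') v'" using Cons.prems(2) unfolding Cons .
      then show ?thesis
        using ghost_mon_ed_Cons_ne[OF _ a False] Cons px by (auto intro: N_mult_right)
    next
      case True
      have w: "walk S w (a # q') v'" using Cons.prems(2) unfolding Cons True .
      have "ghost_mon v' q * ed a * (edges p * x) \<approx> ghost_mon v' q' * (edges p * x)"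
        using ghost_mon_ed_Cons[OF w] px Cons True by (auto intro: eqv_mult_right)
      also have "\<dots> \<in> N"
      proof (rule Cons.IH[OF p _ Cons.prems(3) _ Cons.prems(5)])
        show "walk S (target a) q' v'" using w by simp
        show "q' \<noteq> p" using Cons.prems(4) Cons True by simp
        show "gh e * x \<in> N" if "e \<in> set q'" for e
          using that Cons.prems(6) Cons by simp
      qed
      finally show ?thesis .
    qed
  qed
  then show ?case by (simp add: mult.assoc)
qed

section \<open>Ideals generated by initial segments of vertices\<close>

lemma vx_F: "v \<in> S \<Longrightarrow> vx v \<in> F"
  by (simp add: augmentation_ideal_gen)

text \<open>The ideal of the overview pulled back to the free algebra; the relators are included so
  that it lies above \<open>N\<close>.\<close>

definition vertex_ideal :: "nat \<Rightarrow> (nat, nat, 'k) ncpoly set"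
  where "vertex_ideal k =
    Idl\<^bsub>free_algebra E\<^esub> (leavitt_relators E \<union> vx ` ({..<k} \<inter> S))"

lemma vertex_ideal_gens:
  "leavitt_relators E \<union> vx ` ({..<k} \<inter> S) \<subseteq> (F :: (nat, nat, 'k) ncpoly set)"
  using relators_subset by (auto intro: augmentation_ideal_gen)

lemma alg_ideal_vertex_ideal: "alg_ideal E (vertex_ideal k)"
  unfolding vertex_ideal_def using vertex_ideal_gens F_carrier
  by (intro alg_ideal_genideal) blast

lemma gens_subset_vertex_ideal: "leavitt_relators E \<union> vx ` ({..<k} \<inter> S) \<subseteq> vertex_ideal k"
  unfolding vertex_ideal_def using vertex_ideal_gens F_carrier
  by (intro genideal_free_self) blast

lemma N_subset_vertex_ideal: "N \<subseteq> vertex_ideal k"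
  unfolding N_def using alg_ideal_vertex_ideal gens_subset_vertex_ideal
  by (intro genideal_free_minimal) auto

lemma vx_vertex_ideal: "i < k \<Longrightarrow> i \<in> S \<Longrightarrow> vx i \<in> vertex_ideal k"
  using gens_subset_vertex_ideal by auto

lemma ideal_above_vertex_ideal: "ideal_above E N (vertex_ideal k)"
proof -
  have "vertex_ideal k \<subseteq> F"
    unfolding vertex_ideal_def
    by (rule genideal_free_minimal[OF alg_ideal_augmentation_ideal vertex_ideal_gens])
  then show ?thesis
    using alg_ideal_vertex_ideal[of k] N_subset_vertex_ideal[of k]
      alg_ideal_uminus[OF alg_ideal_vertex_ideal[of k]] F_carrier
    unfolding ideal_above_def alg_ideal_def by blast
qed

context
  fixes I :: "(nat, nat, 'k) ncpoly set"
  assumes I: "ideal_above E N I"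
begin

lemma I_N: "x \<in> N \<Longrightarrow> x \<in> I"
  and I_F: "x \<in> I \<Longrightarrow> x \<in> F"
  and I_add: "x \<in> I \<Longrightarrow> y \<in> I \<Longrightarrow> x + y \<in> I"
  and I_uminus: "x \<in> I \<Longrightarrow> - x \<in> I"
  and I_mult_left: "a \<in> F \<Longrightarrow> x \<in> I \<Longrightarrow> a * x \<in> I"
  and I_mult_right: "a \<in> F \<Longrightarrow> x \<in> I \<Longrightarrow> x * a \<in> I"
  using I by (auto simp: ideal_above_def)

lemma I_diff: "x \<in> I \<Longrightarrow> y \<in> I \<Longrightarrow> x - y \<in> I"
  using I_add[of x "- y"] I_uminus by simp

lemma I_eqv: "x \<approx> y \<Longrightarrow> y \<in> I \<Longrightarrow> x \<in> I"
  unfolding eqv_def using I_add[of "x - y" y] I_N by simp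

lemma I_sum: "(\<And>t. t \<in> T \<Longrightarrow> f t \<in> I) \<Longrightarrow> sum f T \<in> I"
  by (induction T rule: infinite_finite_induct) (auto intro: I_add I_N N_0)

text \<open>An edge \<open>e\<close> from \<open>j + 1\<close> to \<open>j\<close> gives
  \<open>j = e* (j + 1) e\<close> modulo \<open>N\<close>.\<close>

lemma vx_descend:
  assumes "vx j \<in> I" "j \<in> S" "i \<le> j"
  shows "vx i \<in> I"
  using assms
proof (induction j)
  case (Suc j)
  show ?case
  proof (cases "i = Suc j")
    case False
    define e where "e = prod_encode (j, 0)"
    have e: "target e = j" by (simp add: e_def target_def)
    have F: "gh e \<in> F" "ed e \<in> F"
      using e Suc.prems by (auto intro: augmentation_ideal_gen)
    have C: "gh e \<in> C" using F F_carrier by blast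
    have "gh e * (vx (Suc j) * ed e) \<approx> gh e * ed e"
      using vx_ed[of e] e Suc.prems C by (auto intro: eqv_mult_left)
    also have "\<dots> \<approx> vx j"
      using gh_ed[of e] e Suc.prems by simp
    finally have "vx j \<in> I"
      using I_eqv[OF eqv_sym] I_mult_left[OF F(1) I_mult_right[OF F(2)]] Suc.prems by blast
    then show ?thesis
      using Suc False Suc_S by simp
  qed (use Suc in simp)
qed simp

text \<open>Since \<open>I\<close> is not known to be closed under scalars, the inverse of
  \<open>c\<close> enters as the ring element \<open>(1 / c) v\<close>.\<close>

lemma const_vx_I:
  assumes "const c * vx v \<in> I" "c \<noteq> 0" "v \<in> S"
  shows "vx v \<in> I"
proof -
  have "const (1 / c) * vx v \<in> F"
    using assms vx_F by (intro F_mult_left) auto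
  then have "const (1 / c) * vx v * (const c * vx v) \<in> I"
    using assms(1) by (rule I_mult_left)
  also have "const (1 / c) * vx v * (const c * vx v) = const (1 / c) * const c * (vx v * vx v)"
    by (simp only: mult.assoc const_commute[of c "vx v * vx v"] const_commute[of c "vx v"])
  also have "\<dots> = vx v * vx v"
    using assms by (simp add: const_mult[symmetric])
  finally show ?thesis
    using I_eqv[OF eqv_sym[OF vx_vx]] assms by blast
qed

text \<open>By idempotence the middle vertex splits off as a factor that lies in \<open>I\<close>;
  the scalar goes into the left factor, which has no constant term.\<close>

lemma const_mon_I:
  assumes "(p, v, q) \<in> walk_pairs" "vx v \<in> I"
  shows "const c * mon (p, v, q) \<in> I"
proof -
  obtain u w where pq: "walk S u p v" "walk S w q v"
    using assms by (auto simp: walk_pairs_def)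
  then have v: "v \<in> S" using walk_mem by blast
  have pv: "const c * path_mon p v \<in> F"
    unfolding path_mon_def using pq v vx_F edges_C by (intro F_mult_left) auto
  have vq: "ghost_mon v q \<in> F"
    unfolding ghost_mon_def using pq v vx_F ghosts_C by (intro F_mult_right) auto
  have "path_mon p v \<approx> path_mon p v * vx v"
    unfolding path_mon_def mult.assoc
    by (rule eqv_mult_left[OF edges_C[OF pq(1)] eqv_sym[OF vx_vx[OF v]]])
  then have "mon (p, v, q) \<approx> path_mon p v * vx v * ghost_mon v q"
    unfolding mon_def split_conv by (rule eqv_mult_right[OF ghost_mon_C[OF pq(2)]])
  then have "const c * mon (p, v, q) \<approx> const c * (path_mon p v * vx v * ghost_mon v q)"
    by (intro eqv_mult_left) auto
  also have "\<dots> = const c * path_mon p v * (vx v * ghost_mon v q)"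
    by (simp add: mult.assoc)
  finally show ?thesis
    by (rule I_eqv) (rule I_mult_left[OF pv I_mult_right[OF vq assms(2)]])
qed

end

text \<open>
  Choose a term \<open>p\<^sub>0 v\<^sub>0 q\<^sub>0\<^sup>*\<close> with \<open>v\<^sub>0\<close> maximal. If \<open>f\<close> is an edge at \<open>v\<^sub>0\<close> that
  occurs nowhere in the finitely many terms, then multiplying by \<open>f\<^sup>* p\<^sub>0\<^sup>*\<close> and \<open>q\<^sub>0 f\<close> kills all
  other terms and leaves the vertex below \<open>v\<^sub>0\<close>. When \<open>v\<^sub>0 = k\<close> no such \<open>f\<close> is wanted: all terms
  then end at \<open>k\<close>, and the vertex \<open>k\<close> takes the role of \<open>f\<close>.
\<close>

lemma reduction:
  assumes I: "ideal_above E N I" and k: "k \<in> S" "vx k \<notin> I"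
    and T: "finite T" "T \<subseteq> walk_pairs" "T \<noteq> {}"
    and c: "\<And>t. t \<in> T \<Longrightarrow> c t \<noteq> 0"
    and ge: "\<And>p v q. (p, v, q) \<in> T \<Longrightarrow> k \<le> v"
  shows "(\<Sum>t\<in>T. const (c t) * mon t) \<notin> I"
proof
  assume sum: "(\<Sum>t\<in>T. const (c t) * mon t) \<in> I"
  let ?mid = "\<lambda>t :: nat list \<times> nat \<times> nat list. fst (snd t)"
  obtain t\<^sub>0 where t\<^sub>0: "t\<^sub>0 \<in> T" "\<And>t. t \<in> T \<Longrightarrow> ?mid t \<le> ?mid t\<^sub>0"
  proof -
    have "Max (?mid ` T) \<in> ?mid ` T"
      using T(1,3) by (intro Max_in) auto
    then obtain t where "t \<in> T" "?mid t = Max (?mid ` T)" by force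
    then show ?thesis
      using T(1) by (intro that[of t]) auto
  qed
  obtain p\<^sub>0 v\<^sub>0 q\<^sub>0 where t\<^sub>0_eq: "t\<^sub>0 = (p\<^sub>0, v\<^sub>0, q\<^sub>0)" by (cases t\<^sub>0)
  obtain u\<^sub>0 w\<^sub>0 where w\<^sub>0: "walk S u\<^sub>0 p\<^sub>0 v\<^sub>0" "walk S w\<^sub>0 q\<^sub>0 v\<^sub>0"
    using t\<^sub>0(1) T(2) by (auto simp: t\<^sub>0_eq walk_pairs_def)
  have v\<^sub>0: "v\<^sub>0 \<in> S" "k \<le> v\<^sub>0"
    using w\<^sub>0 walk_mem ge t\<^sub>0 t\<^sub>0_eq by auto
  have walks: "\<exists>u w. walk S u p v \<and> walk S w q v" "k \<le> v" "v \<le> v\<^sub>0" if "(p, v, q) \<in> T" for p v q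
    using that T(2) ge t\<^sub>0(2)[OF that] by (auto simp: t\<^sub>0_eq walk_pairs_def)
  \<comment> \<open>Common interface of the two cases. The conditions on \<open>x\<close> and
    \<open>y\<close> are those of \<open>ghosts_path_mon_ne\<close> and
    \<open>ghost_mon_edges_ne\<close>; \<open>k \<le> j\<close> ensures that \<open>vx j\<close> in
    \<open>I\<close> would force \<open>vx k\<close> into \<open>I\<close>.\<close>
  obtain x y j where xy: "x \<in> F" "y \<in> F" "k \<le> j" "j \<in> S" "x * vx v\<^sub>0 * (vx v\<^sub>0 * y) \<approx> vx j"
    and xv\<^sub>0: "x * vx v\<^sub>0 \<approx> x"
    and x: "\<And>p v q e. (p, v, q) \<in> T \<Longrightarrow> e \<in> set p \<Longrightarrow> x * ed e \<in> N"
    and y: "\<And>p v q e. (p, v, q) \<in> T \<Longrightarrow> e \<in> set q \<Longrightarrow> gh e * y \<in> N"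
  proof (cases "v\<^sub>0 = k")
    case True
    \<comment> \<open>Every edge in \<open>T\<close> starts strictly above the end of its path,
      hence above \<open>k\<close>; so the vertex \<open>k\<close> kills the edge from the left and
      its ghost from the right.\<close>
    have e: "Suc (target e) \<in> S \<and> k \<noteq> Suc (target e)"
      if pvq: "(p, v, q) \<in> T" and e: "e \<in> set p \<or> e \<in> set q" for p v q e
    proof -
      obtain u w where "walk S u p v" "walk S w q v"
        using walks(1)[OF pvq] by blast
      then have "Suc (target e) \<in> S \<and> v \<le> target e"
        using e walk_arcs by blast
      then show ?thesis using walks(2)[OF pvq] by auto
    qed
    have "vx k * vx k * (vx k * vx k) \<approx> vx k * (vx k * vx k)"
      using k(1) by (intro eqv_mult_right vx_vx) auto
    also have "\<dots> \<approx> vx k * vx k"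
      using k(1) by (intro eqv_mult_left vx_vx) auto
    also have "\<dots> \<approx> vx k"
      using k(1) by (rule vx_vx)
    finally have "vx k * vx v\<^sub>0 * (vx v\<^sub>0 * vx k) \<approx> vx k"
      by (simp add: True)
    moreover have "vx k * vx v\<^sub>0 \<approx> vx k"
      using vx_vx[OF k(1)] by (simp add: True)
    moreover have "vx k * ed e \<in> N" if "(p, v, q) \<in> T" "e \<in> set p" for p v q e
      using e[OF that(1)] that(2) k(1) by (intro vx_ed_ne) auto
    moreover have "gh e * vx k \<in> N" if "(p, v, q) \<in> T" "e \<in> set q" for p v q e
      using e[OF that(1)] that(2) k(1) by (intro gh_vx_ne) auto
    ultimately show ?thesis
      using vx_F[OF k(1)] k(1) by (intro that[of "vx k" "vx k" k]) auto
  next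
    case False
    \<comment> \<open>Here \<open>k < v\<^sub>0\<close>, so one step down from
      \<open>v\<^sub>0\<close> still stays at or above \<open>k\<close>.\<close>
    define j where "j = v\<^sub>0 - 1"
    have j: "v\<^sub>0 = Suc j" "k \<le> j" "j \<in> S"
      using False v\<^sub>0 Suc_S[of j] by (auto simp: j_def)
    define A where "A = (\<Union>t\<in>T. set (fst t) \<union> set (snd (snd t)))"
    have "finite A" using T(1) by (auto simp: A_def)
    then obtain f where f: "target f = j" "f \<notin> A"
      using infinite_target[of j] finite_subset[of "{f. target f = j}" A] by blast
    have fS: "Suc (target f) \<in> S" using f j v\<^sub>0 by simp
    have e: "Suc (target e) \<in> S \<and> e \<noteq> f"
      if pvq: "(p, v, q) \<in> T" and e: "e \<in> set p \<or> e \<in> set q" for p v q e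
    proof -
      obtain u w where "walk S u p v" "walk S w q v"
        using walks(1)[OF pvq] by blast
      then have "Suc (target e) \<in> S"
        using e walk_arcs by blast
      moreover have "e \<in> A"
        using pvq e by (force simp: A_def)
      ultimately show ?thesis using f(2) by auto
    qed
    have xv: "gh f * vx v\<^sub>0 \<approx> gh f"
      using f j gh_vx[OF fS] by simp
    have "gh f * vx v\<^sub>0 * (vx v\<^sub>0 * ed f) \<approx> gh f * (vx v\<^sub>0 * ed f)"
      using fS v\<^sub>0 by (intro eqv_mult_right xv) auto
    also have "\<dots> \<approx> gh f * ed f"
      using f fS j v\<^sub>0 vx_ed[OF fS] by (intro eqv_mult_left) auto
    also have "\<dots> \<approx> vx j"
      using gh_ed[OF fS] f by simp
    finally have "gh f * vx v\<^sub>0 * (vx v\<^sub>0 * ed f) \<approx> vx j" .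
    moreover have "gh f * ed e \<in> N" if "(p, v, q) \<in> T" "e \<in> set p" for p v q e
      using e[OF that(1)] that(2) fS by (intro gh_ed_ne) auto
    moreover have "gh e * ed f \<in> N" if "(p, v, q) \<in> T" "e \<in> set q" for p v q e
      using e[OF that(1)] that(2) fS by (intro gh_ed_ne) auto
    moreover have "gh f \<in> F" "ed f \<in> F"
      using fS by (auto intro!: augmentation_ideal_gen)
    ultimately show ?thesis
      using xv j by (intro that[of "gh f" "ed f" j])
  qed
  define a where "a = x * ghosts p\<^sub>0"
  define b where "b = edges q\<^sub>0 * y"
  have ab: "a \<in> F" "b \<in> F"
    using xy w\<^sub>0 ghosts_C edges_C by (auto simp: a_def b_def intro: F_mult_left F_mult_right)
  have term_eq: "a * (const d * mon (p, v, q)) * b = const d * (a * path_mon p v * (ghost_mon v q * b))"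
    for d p v q
  proof -
    have "a * (const d * mon (p, v, q)) * b = (a * const d) * path_mon p v * (ghost_mon v q * b)"
      by (simp add: mon_def mult.assoc)
    then show ?thesis
      by (simp add: const_commute[of d a, symmetric] mult.assoc)
  qed
  \<comment> \<open>A term with a different \<open>(p, v)\<close> dies against \<open>a\<close>; one
    with the same \<open>(p, v)\<close> has a different \<open>q\<close> and dies against
    \<open>b\<close>.\<close>
  have zero: "a * (const (c t) * mon t) * b \<in> N" if t: "t \<in> T" "t \<noteq> t\<^sub>0" for t
  proof -
    obtain p v q where t_eq: "t = (p, v, q)" by (cases t)
    obtain u w where uw: "walk S u p v" "walk S w q v"
      using walks(1) t t_eq by blast
    have le: "v \<le> v\<^sub>0" using walks(3) t t_eq by blast
    have "a * path_mon p v * (ghost_mon v q * b) \<in> N"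
    proof (cases "(p, v) = (p\<^sub>0, v\<^sub>0)")
      case False
      then have "a * path_mon p v \<in> N"
        unfolding a_def using xy F_carrier xv\<^sub>0 x t t_eq
        by (intro ghosts_path_mon_ne[OF w\<^sub>0(1) uw(1) le]) auto
      moreover have "ghost_mon v q * b \<in> C"
        using ab ghost_mon_C[OF uw(2)] F_carrier by simp
      ultimately show ?thesis
        by (intro N_mult_right[of "ghost_mon v q * b"])
    next
      case True
      then have "q \<noteq> q\<^sub>0" using t t_eq t\<^sub>0_eq by auto
      then have "ghost_mon v q * b \<in> N"
        unfolding b_def using xy F_carrier y t t_eq
        by (intro ghost_mon_edges_ne[OF w\<^sub>0(2) uw(2) le]) auto
      moreover have "a * path_mon p v \<in> C"
        using ab path_mon_C[OF uw(1)] F_carrier by simp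
      ultimately show ?thesis
        by (intro N_mult_left[of "a * path_mon p v"])
    qed
    then show ?thesis
      by (simp add: t_eq term_eq N_mult_left)
  qed
  have one: "a * (const (c t\<^sub>0) * mon t\<^sub>0) * b \<approx> const (c t\<^sub>0) * vx j"
  proof -
    have "a * path_mon p\<^sub>0 v\<^sub>0 * (ghost_mon v\<^sub>0 q\<^sub>0 * b) \<approx> x * vx v\<^sub>0 * (ghost_mon v\<^sub>0 q\<^sub>0 * b)"
      unfolding a_def using xy w\<^sub>0 ab F_carrier ghost_mon_C
      by (intro eqv_mult_right ghosts_path_mon_same) auto
    also have "\<dots> \<approx> x * vx v\<^sub>0 * (vx v\<^sub>0 * y)"
      unfolding b_def using xy w\<^sub>0 v\<^sub>0 F_carrier
      by (intro eqv_mult_left ghost_mon_edges_same) auto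
    also have "\<dots> \<approx> vx j" by (rule xy)
    finally show ?thesis
      by (simp add: t\<^sub>0_eq term_eq eqv_mult_left)
  qed
  have "(\<Sum>t\<in>T - {t\<^sub>0}. a * (const (c t) * mon t) * b) \<in> I"
    using zero by (intro I_sum[OF I] I_N[OF I]) auto
  moreover have "a * (\<Sum>t\<in>T. const (c t) * mon t) * b \<in> I"
    using sum ab by (intro I_mult_left[OF I] I_mult_right[OF I])
  moreover have "a * (\<Sum>t\<in>T. const (c t) * mon t) * b =
      a * (const (c t\<^sub>0) * mon t\<^sub>0) * b + (\<Sum>t\<in>T - {t\<^sub>0}. a * (const (c t) * mon t) * b)"
    by (simp add: sum.remove[OF T(1) t\<^sub>0(1)] distrib_left distrib_right sum_distrib_left
        sum_distrib_right)
  ultimately have "a * (const (c t\<^sub>0) * mon t\<^sub>0) * b + (\<Sum>t\<in>T - {t\<^sub>0}. a * (const (c t) * mon t) * b)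
      - (\<Sum>t\<in>T - {t\<^sub>0}. a * (const (c t) * mon t) * b) \<in> I"
    by (intro I_diff[OF I]) simp_all
  then have "a * (const (c t\<^sub>0) * mon t\<^sub>0) * b \<in> I" by simp
  then have "const (c t\<^sub>0) * vx j \<in> I"
    using I_eqv[OF I eqv_sym[OF one]] by blast
  then have "vx j \<in> I"
    using c[OF t\<^sub>0(1)] xy by (intro const_vx_I[OF I])
  then show False
    using vx_descend[OF I] xy k by blast
qed

text \<open>Terms ending below \<open>k\<close> lie in \<open>I\<close> and in
  \<open>vertex_ideal k\<close>. Subtracting them leaves an element of \<open>I\<close> whose terms
  all end at \<open>k\<close> or above, and \<open>reduction\<close> shows that there are
  none.\<close>

lemma subset_vertex_ideal:
  assumes I: "ideal_above E N I" and k: "k \<in> S" "vx k \<notin> I"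
    and less: "\<And>i. i < k \<Longrightarrow> vx i \<in> I"
  shows "I \<subseteq> vertex_ideal k"
proof
  fix x assume x: "x \<in> I"
  then obtain T c where T: "finite T" "T \<subseteq> walk_pairs" "x \<approx> (\<Sum>t\<in>T. const (c t) * mon t)"
    using path_span_sum[OF F_path_span[OF I_F[OF I]]] by blast
  \<comment> \<open>Zero coefficients are dropped too, because \<open>reduction\<close> asks for
    nonzero ones.\<close>
  define T' where "T' = {t \<in> T. c t \<noteq> 0 \<and> k \<le> fst (snd t)}"
  have rest: "const (c t) * mon t \<in> I \<inter> vertex_ideal k" if t: "t \<in> T - T'" for t
  proof (cases "c t = 0")
    case True
    then show ?thesis
      using I_N[OF I N_0] I_N[OF ideal_above_vertex_ideal N_0] by simp
  next
    case False
    obtain p v q where t_eq: "t = (p, v, q)" by (cases t)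
    have pvq: "(p, v, q) \<in> walk_pairs" "v < k"
      using t T(2) False by (auto simp: t_eq T'_def)
    then have "v \<in> S" using walk_mem by (auto simp: walk_pairs_def)
    then show ?thesis
      unfolding t_eq
      using const_mon_I[OF I pvq(1) less[OF pvq(2)]]
        const_mon_I[OF ideal_above_vertex_ideal pvq(1) vx_vertex_ideal[OF pvq(2)]] by blast
  qed
  have split: "(\<Sum>t\<in>T. const (c t) * mon t) =
      (\<Sum>t\<in>T'. const (c t) * mon t) + (\<Sum>t\<in>T - T'. const (c t) * mon t)"
    using T(1) by (subst sum.subset_diff[of T' T]) (auto simp: T'_def add.commute)
  have "(\<Sum>t\<in>T. const (c t) * mon t) \<in> I"
    using I_eqv[OF I eqv_sym[OF T(3)] x] .
  moreover have "(\<Sum>t\<in>T - T'. const (c t) * mon t) \<in> I"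
    using rest by (intro I_sum[OF I]) auto
  ultimately have "(\<Sum>t\<in>T'. const (c t) * mon t) + (\<Sum>t\<in>T - T'. const (c t) * mon t)
      - (\<Sum>t\<in>T - T'. const (c t) * mon t) \<in> I"
    unfolding split by (rule I_diff[OF I])
  then have "(\<Sum>t\<in>T'. const (c t) * mon t) \<in> I" by simp
  moreover have "finite T'" "T' \<subseteq> walk_pairs"
    using T by (auto simp: T'_def)
  moreover have "c t \<noteq> 0" if "t \<in> T'" for t
    using that by (simp add: T'_def)
  moreover have "k \<le> v" if "(p, v, q) \<in> T'" for p v q
    using that by (simp add: T'_def)
  ultimately have "T' = {}"
    using reduction[OF I k, of T' c] by blast
  then have "(\<Sum>t\<in>T. const (c t) * mon t) \<in> vertex_ideal k"
    using rest by (intro I_sum[OF ideal_above_vertex_ideal]) auto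
  then show "x \<in> vertex_ideal k"
    using I_eqv[OF ideal_above_vertex_ideal T(3)] by blast
qed

text \<open>Each spanning product has a vertex as a factor.\<close>

lemma eq_F:
  assumes I: "ideal_above E N I" and vx: "\<And>v. v \<in> S \<Longrightarrow> vx v \<in> I"
  shows "I = F"
proof
  show "I \<subseteq> F" using I_F[OF I] by blast
  show "F \<subseteq> I"
  proof
    fix x assume "x \<in> F"
    then obtain T c where T: "T \<subseteq> walk_pairs" "x \<approx> (\<Sum>t\<in>T. const (c t) * mon t)"
      using path_span_sum[OF F_path_span] by blast
    have "const (c t) * mon t \<in> I" if t: "t \<in> T" for t
    proof -
      obtain p v q where t_eq: "t = (p, v, q)" by (cases t)
      have "(p, v, q) \<in> walk_pairs" using t T(1) t_eq by blast
      moreover from this have "v \<in> S" using walk_mem by (auto simp: walk_pairs_def)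
      ultimately show ?thesis
        unfolding t_eq using const_mon_I[OF I] vx by blast
    qed
    then show "x \<in> I"
      by (intro I_eqv[OF I T(2)] I_sum[OF I])
  qed
qed

lemma free_carrier_split:
  assumes "a \<in> C"
  obtains d b where "a = const d + b" "b \<in> F"
proof
  let ?b = "a - const (Poly_Mapping.lookup a 0)"
  show "a = const (Poly_Mapping.lookup a 0) + ?b" by simp
  have "0 \<notin> Poly_Mapping.keys ?b"
    by (simp add: in_keys_iff lookup_minus const_def)
  then show "?b \<in> F"
    using assms by (simp add: augmentation_ideal_def)
qed

text \<open>
  \<^const>\<open>ideal_above\<close> does not ask for closure under scalars, so the elements all of whose scalar
  multiples lie in \<open>I\<close> are shown to form an ideal of the free algebra.
\<close>

lemma vertex_ideal_subset:
  assumes I: "ideal_above E N I" and less: "\<And>i. i < k \<Longrightarrow> i \<in> S \<Longrightarrow> vx i \<in> I"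
  shows "vertex_ideal k \<subseteq> I"
proof -
  define J where "J = {x. \<forall>c. const c * x \<in> I}"
  have J_I: "x \<in> I" if "x \<in> J" for x
    using that[unfolded J_def mem_Collect_eq, THEN spec, of 1] by simp
  have "alg_ideal E J"
    unfolding alg_ideal_def
  proof (intro conjI ballI)
    show "J \<subseteq> C" using J_I I_F[OF I] F_carrier by blast
    show "0 \<in> J" using I_N[OF I N_0] by (simp add: J_def)
    show "x + y \<in> J" if "x \<in> J" "y \<in> J" for x y
      using that I_add[OF I] by (simp add: J_def distrib_left)
    fix a x assume a: "a \<in> C" and x: "x \<in> J"
    obtain d b where ab: "a = const d + b" "b \<in> F"
      using free_carrier_split[OF a] by blast
    have "const c * (a * x) \<in> I" "const c * (x * a) \<in> I" for c
    proof -
      have cd: "const (c * d) * x \<in> I" using x unfolding J_def by blast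
      have cb: "const c * b \<in> F" using ab by (intro F_mult_left) auto
      have "const c * (a * x) = const (c * d) * x + const c * b * x"
        by (simp add: ab const_mult algebra_simps)
      also have "\<dots> \<in> I"
        by (intro I_add[OF I cd] I_mult_left[OF I cb] J_I x)
      finally show "const c * (a * x) \<in> I" .
      have "const c * (x * b) = x * (const c * b)"
        by (simp add: mult.assoc[symmetric] const_commute[of c x])
      then have "const c * (x * a) = const (c * d) * x + x * (const c * b)"
        by (simp only: ab distrib_left const_mult mult.assoc const_commute[of d x, symmetric])
      also have "\<dots> \<in> I"
        by (intro I_add[OF I cd] I_mult_right[OF I cb] J_I x)
      finally show "const c * (x * a) \<in> I" .
    qed
    then show "a * x \<in> J" "x * a \<in> J" by (auto simp: J_def)
  qed
  moreover have "leavitt_relators E \<subseteq> J"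
  proof
    fix x :: "(nat, nat, 'k) ncpoly" assume "x \<in> leavitt_relators E"
    then have "const c * x \<in> N" for c
      using relators_N by (intro N_mult_left) auto
    then show "x \<in> J" using I_N[OF I] by (simp add: J_def)
  qed
  moreover have "vx i \<in> J" if i: "i < k" "i \<in> S" for i
  proof -
    have "const c * vx i \<in> I" for c
    proof -
      \<comment> \<open>Idempotence turns the scalar multiple into a product of \<open>c i\<close>,
        from the augmentation ideal, with \<open>i\<close>, from \<open>I\<close>.\<close>
      have "const c * vx i \<approx> const c * vx i * vx i"
        unfolding mult.assoc using i by (intro eqv_mult_left eqv_sym[OF vx_vx]) auto
      moreover have "const c * vx i * vx i \<in> I"
        using i vx_F by (intro I_mult_left[OF I] F_mult_left less) auto
      ultimately show ?thesis by (rule I_eqv[OF I])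
    qed
    then show ?thesis by (simp add: J_def)
  qed
  ultimately have "vertex_ideal k \<subseteq> J"
    unfolding vertex_ideal_def by (intro genideal_free_minimal) auto
  then show ?thesis using J_I by blast
qed

end

section \<open>The representation on functions on the paths ending at a vertex\<close>

text \<open>
  The list \<open>m\<^sub>1, \<dots>, m\<^sub>l\<close> stands for the path from \<open>k + l\<close> to \<open>k\<close> whose \<open>i\<close>-th edge has
  index \<open>m\<^sub>i\<close> among the edges at its source. Vertices below \<open>k\<close> act as zero.
\<close>

fun gen_act :: "nat \<Rightarrow> (nat, nat) generator \<Rightarrow> (nat list \<Rightarrow> 'k::field) \<Rightarrow> nat list \<Rightarrow> 'k"
  where
    "gen_act k (Vertex v) f p = (if k + length p = v then f p else 0)"
  | "gen_act k (Edge e) f [] = 0"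
  | "gen_act k (Edge e) f (m # p) = (if prod_encode (k + length p, m) = e then f p else 0)"
  | "gen_act k (Ghost e) f p =
      (if k + length p = target e then f (snd (prod_decode e) # p) else 0)"

text \<open>With \<open>foldr\<close> the last letter acts first, so concatenation becomes
  composition and the functions form a left module.\<close>

definition word_act ::
    "nat \<Rightarrow> (nat, nat) generator word \<Rightarrow> (nat list \<Rightarrow> 'k::field) \<Rightarrow> nat list \<Rightarrow> 'k"
  where "word_act k w = foldr (gen_act k) (letters w)"

definition poly_act :: "nat \<Rightarrow> (nat, nat, 'k::field) ncpoly \<Rightarrow> (nat list \<Rightarrow> 'k) \<Rightarrow> nat list \<Rightarrow> 'k"
  where "poly_act k x f p =
    (\<Sum>w\<in>Poly_Mapping.keys x. Poly_Mapping.lookup x w * word_act k w f p)"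

lemma gen_act_linear:
  "gen_act k g (\<lambda>p. a * f p + b * h p) = (\<lambda>p. a * gen_act k g f p + b * gen_act k g h p)"
proof
  fix p
  show "gen_act k g (\<lambda>p. a * f p + b * h p) p = a * gen_act k g f p + b * gen_act k g h p"
    by (cases g; cases p) auto
qed

lemma word_act_linear:
  "word_act k w (\<lambda>p. a * f p + b * h p) = (\<lambda>p. a * word_act k w f p + b * word_act k w h p)"
proof -
  have "foldr (gen_act k) l (\<lambda>p. a * f p + b * h p) =
      (\<lambda>p. a * foldr (gen_act k) l f p + b * foldr (gen_act k) l h p)" for l
    by (induction l) (simp_all add: gen_act_linear)
  then show ?thesis by (simp add: word_act_def)
qed

lemma word_act_zero_fun: "word_act k w (\<lambda>p. 0 :: 'k::field) = (\<lambda>p. 0)"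
  using word_act_linear[of k w "0 :: 'k" "\<lambda>_. 0" 0 "\<lambda>_. 0"] by simp

lemma word_act_plus: "word_act k (u + w) f = word_act k u (word_act k w f)"
  by (simp add: word_act_def plus_word_def)

lemma poly_act_superset:
  assumes "finite A" "Poly_Mapping.keys x \<subseteq> A"
  shows "poly_act k x f p = (\<Sum>w\<in>A. Poly_Mapping.lookup x w * word_act k w f p)"
  unfolding poly_act_def using assms
  by (intro sum.mono_neutral_left) (auto simp: in_keys_iff)

lemma poly_act_0 [simp]: "poly_act k 0 f p = 0"
  by (simp add: poly_act_def)

lemma poly_act_add: "poly_act k (x + y) f p = poly_act k x f p + poly_act k y f p"
proof -
  let ?A = "Poly_Mapping.keys x \<union> Poly_Mapping.keys y"
  have "poly_act k (x + y) f p = (\<Sum>w\<in>?A. Poly_Mapping.lookup (x + y) w * word_act k w f p)"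
    by (rule poly_act_superset) (use keys_add[of x y] in auto)
  also have "\<dots> = (\<Sum>w\<in>?A. Poly_Mapping.lookup x w * word_act k w f p) +
      (\<Sum>w\<in>?A. Poly_Mapping.lookup y w * word_act k w f p)"
    by (simp add: lookup_add distrib_right sum.distrib)
  also have "\<dots> = poly_act k x f p + poly_act k y f p"
    by (simp add: poly_act_superset[of ?A])
  finally show ?thesis .
qed

lemma poly_act_uminus: "poly_act k (- x) f p = - poly_act k x f p"
  using poly_act_add[of k x "- x" f p] by (simp add: eq_neg_iff_add_eq_0 add.commute)

lemma poly_act_diff: "poly_act k (x - y) f p = poly_act k x f p - poly_act k y f p"
  using poly_act_add[of k x "- y" f p] by (simp add: poly_act_uminus)

lemma poly_act_single: "poly_act k (Poly_Mapping.single w c) f p = c * word_act k w f p"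
  by (simp add: poly_act_superset[of "{w}"])

lemma poly_act_gen: "poly_act k (gen g) f = gen_act k g f"
  by (rule ext) (simp add: gen_def poly_act_single word_act_def)

text \<open>Additivity in both polynomials, together with \<open>word_act_linear\<close>, reduces
  the claim to single words, where it is \<open>word_act_plus\<close>.\<close>

lemma poly_act_mult: "poly_act k (x * y) f = poly_act k x (poly_act k y f)"
proof -
  have single: "poly_act k (Poly_Mapping.single w c * y) f p = c * word_act k w (poly_act k y f) p"
    for w c p
  proof (induction y rule: ncpoly_induct)
    case zero
    have "poly_act k 0 f = (\<lambda>p. 0)" by (rule ext) simp
    then show ?case by (simp add: word_act_zero_fun)
  next
    case (add u q)
    let ?d = "Poly_Mapping.lookup y u"
    have "poly_act k (Poly_Mapping.single u ?d + q) f =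
        (\<lambda>p. ?d * word_act k u f p + poly_act k q f p)"
      by (rule ext) (simp add: poly_act_add poly_act_single)
    then have act: "word_act k w (poly_act k (Poly_Mapping.single u ?d + q) f) p =
        ?d * word_act k (w + u) f p + word_act k w (poly_act k q f) p"
      using word_act_linear[of k w ?d "word_act k u f" 1 "poly_act k q f"]
      by (simp add: word_act_plus)
    have "poly_act k (Poly_Mapping.single w c * (Poly_Mapping.single u ?d + q)) f p =
        c * (?d * word_act k (w + u) f p + word_act k w (poly_act k q f) p)"
      using add
      by (simp add: distrib_left poly_act_add mult_single poly_act_single mult.assoc)
    then show ?case by (simp only: act)
  qed
  have "poly_act k (x * y) f p = poly_act k x (poly_act k y f) p" for p
  proof (induction x rule: ncpoly_induct)
    case (add w q)
    then show ?case
      by (simp add: distrib_right poly_act_add single poly_act_single)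
  qed simp
  then show ?thesis by (rule ext)
qed

lemma poly_act_zero_fun: "poly_act k x (\<lambda>p. 0) = (\<lambda>p. 0)"
  by (rule ext) (simp add: poly_act_def word_act_zero_fun)

text \<open>The kernel of the representation serves as an upper bound for
  \<open>vertex_ideal k\<close> that misses the vertex \<open>k\<close>.\<close>

definition annihilator :: "nat set \<Rightarrow> nat \<Rightarrow> (nat, nat, 'k::field) ncpoly set"
  where "annihilator S k = {x \<in> free_carrier (tower S). \<forall>f. poly_act k x f = (\<lambda>p. 0)}"

lemma alg_ideal_annihilator:
  "alg_ideal (tower S) (annihilator S k :: (nat, nat, 'k::field) ncpoly set)"
proof -
  have "poly_act k (x + y) f = (\<lambda>p. 0)"
    if "poly_act k x f = (\<lambda>p. 0)" "poly_act k y f = (\<lambda>p. 0)"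
    for x y :: "(nat, nat, 'k) ncpoly" and f
    by (rule ext) (simp add: poly_act_add that)
  moreover have "poly_act k 0 f = (\<lambda>p. 0)" for f :: "nat list \<Rightarrow> 'k"
    by (rule ext) simp
  ultimately show ?thesis
    by (auto simp: alg_ideal_def annihilator_def poly_act_mult poly_act_zero_fun)
qed

lemma prod_encode_target [simp]: "prod_encode (target e, snd (prod_decode e)) = e"
  by (simp add: target_def)

lemma target_prod_encode [simp]: "target (prod_encode (i, m)) = i"
  by (simp add: target_def)

context tower_algebra
begin

text \<open>On point masses an edge prepends an entry and its ghost removes it again. The case split
  singles out the empty path, at which the image of an edge vanishes.\<close>

lemma relators_annihilator: "leavitt_relators E \<subseteq> (annihilator S k :: (nat, nat, 'k) ncpoly set)"
proof
  fix x :: "(nat, nat, 'k) ncpoly" assume x: "x \<in> leavitt_relators E"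
  have "poly_act k x f p = 0" for f p
    using x unfolding leavitt_relators_def
    by (cases p) (auto simp: no_regular_vertex_tower poly_act_diff poly_act_mult poly_act_gen)
  moreover have "x \<in> C"
    using x relators_subset F_carrier by blast
  ultimately show "x \<in> annihilator S k"
    by (auto simp: annihilator_def)
qed

lemma vx_annihilator:
  "i < k \<Longrightarrow> i \<in> S \<Longrightarrow> (vx i :: (nat, nat, 'k) ncpoly) \<in> annihilator S k"
  "(vx k :: (nat, nat, 'k) ncpoly) \<notin> annihilator S k"
proof -
  show "(vx i :: (nat, nat, 'k) ncpoly) \<in> annihilator S k" if "i < k" "i \<in> S"
    using that by (auto simp: annihilator_def poly_act_gen)
  \<comment> \<open>The empty path sits at the vertex \<open>k\<close>, which therefore preserves
    the value there.\<close>
  have "poly_act k (vx k :: (nat, nat, 'k) ncpoly) (\<lambda>p. 1) [] \<noteq> 0"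
    by (simp add: poly_act_gen)
  then show "(vx k :: (nat, nat, 'k) ncpoly) \<notin> annihilator S k"
    unfolding annihilator_def by (metis (mono_tags, lifting) mem_Collect_eq)
qed

section \<open>The prime ideals\<close>

lemma vx_not_vertex_ideal: "vx k \<notin> vertex_ideal k"
proof -
  have "vertex_ideal k \<subseteq> annihilator S k"
    unfolding vertex_ideal_def
    by (rule genideal_free_minimal[OF alg_ideal_annihilator])
      (use relators_annihilator vx_annihilator(1) in auto)
  then show ?thesis
    using vx_annihilator(2) by blast
qed

definition tower_prime :: "nat \<Rightarrow> (nat, nat, 'k) ncpoly set set"
  where "tower_prime k = coset ` vertex_ideal k"

text \<open>Vertices tell the ideals apart: for \<open>k \<le> i\<close>,
  \<open>vertex_ideal k\<close> lies in \<open>vertex_ideal i\<close>, which misses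
  \<open>i\<close>.\<close>

lemma vx_tower_prime_iff: "i \<in> S \<Longrightarrow> coset (vx i) \<in> tower_prime k \<longleftrightarrow> i < k"
proof
  assume i: "i \<in> S" and mem: "coset (vx i) \<in> tower_prime k"
  show "i < k"
  proof (rule ccontr)
    assume "\<not> i < k"
    then have "vertex_ideal k \<subseteq> vertex_ideal i"
      by (intro vertex_ideal_subset ideal_above_vertex_ideal vx_vertex_ideal) auto
    then show False
      using mem vx_not_vertex_ideal[of i]
      by (auto simp: tower_prime_def coset_mem_image_iff[OF ideal_above_vertex_ideal])
  qed
qed (simp add: tower_prime_def vx_vertex_ideal)

lemma tower_prime_mono: "j \<le> k \<Longrightarrow> tower_prime j \<subseteq> tower_prime k"
  unfolding tower_prime_def
  by (intro image_mono vertex_ideal_subset ideal_above_vertex_ideal vx_vertex_ideal) auto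

lemma tower_prime_subset_iff:
  assumes "j \<in> S"
  shows "tower_prime j \<subseteq> tower_prime k \<longleftrightarrow> j \<le> k"
proof
  assume sub: "tower_prime j \<subseteq> tower_prime k"
  show "j \<le> k"
  proof (rule ccontr)
    assume "\<not> j \<le> k"
    then have "k < j" "k \<in> S" using le_S[of k j] assms by auto
    then show False
      using sub vx_tower_prime_iff[of k j] vx_tower_prime_iff[of k k] by blast
  qed
qed (rule tower_prime_mono)

text \<open>A proper ideal misses a vertex by \<open>eq_F\<close>. The least one missed determines
  the ideal: \<open>subset_vertex_ideal\<close> bounds it from above,
  \<open>vertex_ideal_subset\<close> from below.\<close>

lemma two_sided_ideal_cases:
  assumes "two_sided_ideal J Q" "J \<noteq> carrier Q"
  obtains k where "k \<in> S" "J = tower_prime k"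
proof -
  note I = ideal_above_preim[OF assms(1)]
  have "preim J \<noteq> F"
    using assms(2) I(2) carrier_Q by metis
  then obtain v where v: "v \<in> S" "vx v \<notin> preim J"
    using eq_F[OF I(1)] by blast
  \<comment> \<open>The minimum runs over all natural numbers; \<open>k \<le> v\<close> brings it
    back into \<open>S\<close>.\<close>
  define k where "k = (LEAST v. vx v \<notin> preim J)"
  have k: "vx k \<notin> preim J" "k \<le> v"
    unfolding k_def using LeastI[of "\<lambda>v. vx v \<notin> preim J", OF v(2)]
      Least_le[of "\<lambda>v. vx v \<notin> preim J", OF v(2)] .
  have less: "vx i \<in> preim J" if "i < k" for i
    using not_less_Least[of i "\<lambda>v. vx v \<notin> preim J"] that unfolding k_def by blast
  have "k \<in> S" using le_S k(2) v(1) by blast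
  moreover have "preim J = vertex_ideal k"
    using subset_vertex_ideal[OF I(1) \<open>k \<in> S\<close> k(1) less] vertex_ideal_subset[OF I(1) less] by blast
  ultimately show ?thesis
    using that I(2) by (metis tower_prime_def)
qed

lemma prime_tower_prime:
  assumes k: "k \<in> S"
  shows "prime_ideal (tower_prime k) Q"
proof -
  have F: "vx k \<in> F" using k by (rule vx_F)
  have mem: "coset (vx k) \<in> carrier Q"
    using F by (simp add: carrier_Q)
  have sq: "coset (vx k) \<otimes>\<^bsub>Q\<^esub> coset (vx k) = coset (vx k)"
    using vx_vx[OF k] F by (simp add: mult_Q coset_eq_iff eqv_def)
  have notin: "coset (vx k) \<notin> tower_prime k"
    using k by (simp add: vx_tower_prime_iff)
  \<comment> \<open>Proper ideals form a chain, so \<open>A\<close> is the whole ring or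
    \<open>tower_prime j\<close> with \<open>k < j\<close>.\<close>
  have large: "coset (vx k) \<in> A" if A: "two_sided_ideal A Q" "\<not> A \<subseteq> tower_prime k" for A
  proof (cases "A = carrier Q")
    case False
    then obtain j where "j \<in> S" "A = tower_prime j"
      using two_sided_ideal_cases[OF A(1)] by blast
    then show ?thesis
      using A(2) k tower_prime_subset_iff[of j k] by (simp add: vx_tower_prime_iff)
  qed (use mem in simp)
  have "A \<subseteq> tower_prime k \<or> B \<subseteq> tower_prime k"
    if AB: "two_sided_ideal A Q" "two_sided_ideal B Q" "ideal_prod Q A B \<subseteq> tower_prime k" for A B
  proof (rule ccontr)
    assume "\<not> (A \<subseteq> tower_prime k \<or> B \<subseteq> tower_prime k)"
    then have "coset (vx k) \<in> A" "coset (vx k) \<in> B"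
      using large AB by blast+
    then have "coset (vx k) \<in> ideal_prod Q A B"
      using ideal_prod.prod[of _ A _ B Q] sq by metis
    then show False using AB(3) notin by blast
  qed
  moreover have "two_sided_ideal (tower_prime k) Q"
    unfolding tower_prime_def by (rule two_sided_ideal_coset[OF ideal_above_vertex_ideal])
  moreover have "tower_prime k \<noteq> carrier Q"
    using mem notin by blast
  ultimately show ?thesis
    unfolding prime_ideal_def by blast
qed

lemma prime_ideal_tower_iff:
  "prime_ideal P (leavitt_path_algebra E) \<longleftrightarrow> (\<exists>k\<in>S. P = tower_prime k)"
proof
  assume "prime_ideal P (leavitt_path_algebra E)"
  then have "two_sided_ideal P Q" "P \<noteq> carrier Q"
    unfolding leavitt_path_algebra_E prime_ideal_def by blast+
  then show "\<exists>k\<in>S. P = tower_prime k"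
    using two_sided_ideal_cases by metis
qed (use prime_tower_prime in \<open>auto simp: leavitt_path_algebra_E\<close>)

lemma tower_prime_psubset_iff:
  assumes "i \<in> S" "j \<in> S"
  shows "tower_prime i \<subset> tower_prime j \<longleftrightarrow> i < j"
  using tower_prime_subset_iff[OF assms(1), of j] tower_prime_subset_iff[OF assms(2), of i]
  by auto

lemma inj_on_tower_prime: "inj_on tower_prime S"
  by (rule inj_onI) (metis order_antisym order_refl tower_prime_subset_iff)

end

lemma wf_digraph_tower:
  assumes "\<And>i. Suc i \<in> S \<Longrightarrow> i \<in> S"
  shows "wf_digraph (tower S)"
  by unfold_locales (use assms in auto)

section \<open>Finite towers\<close>

text \<open>The vertices \<open>0, ..., n\<close> give \<open>n + 1\<close> primes, hence
  \<open>n\<close> strict inclusions.\<close>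

lemma has_krull_dimension_tower:
  "has_krull_dimension (leavitt_path_algebra (tower {..n}) :: (nat, nat, 'k::field) ncpoly set ring) n"
proof -
  interpret tower_algebra "{..n}" "TYPE('k)"
    by unfold_locales auto
  let ?L = "leavitt_path_algebra E :: (nat, nat, 'k) ncpoly set ring"
  have le: "m \<le> n" if chain: "has_prime_chain ?L m" for m
  proof -
    obtain P where P: "\<And>i. i \<le> m \<Longrightarrow> prime_ideal (P i) ?L" "\<And>i. i < m \<Longrightarrow> P i \<subset> P (Suc i)"
      using chain by (auto simp: has_prime_chain_def)
    have "\<forall>i\<in>{..m}. \<exists>k\<in>{..n}. P i = tower_prime k"
      using P(1) prime_ideal_tower_iff by auto
    then obtain g where g: "\<And>i. i \<le> m \<Longrightarrow> g i \<in> {..n} \<and> P i = tower_prime (g i)"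
      by (metis atMost_iff)
    \<comment> \<open>The indices increase strictly along the chain, so they grow at least as fast
      as \<open>i\<close>; at \<open>i = m\<close> this gives
      \<open>m \<le> g m \<le> n\<close>.\<close>
    have "i \<le> m \<Longrightarrow> i \<le> g i" for i
    proof (induction i)
      case (Suc i)
      have "g i < g (Suc i)"
        using P(2)[of i] g[of i] g[of "Suc i"] Suc.prems
          tower_prime_psubset_iff[of "g i" "g (Suc i)"] by auto
      then show ?case using Suc by simp
    qed simp
    then show ?thesis using g[of m] by fastforce
  qed
  have "has_prime_chain ?L n"
    unfolding has_prime_chain_def
  proof (intro exI[of _ tower_prime] conjI allI impI)
    show "prime_ideal (tower_prime i) ?L" if "i \<le> n" for i
      using that by (auto simp: prime_ideal_tower_iff)
    show "tower_prime i \<subset> tower_prime (Suc i)" if "i < n" for i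
      using that by (simp add: tower_prime_psubset_iff)
  qed
  then have n: "n \<in> {k. has_prime_chain ?L k}" by simp
  moreover have "Sup {k. has_prime_chain ?L k} = n"
    using n le by (intro cSup_eq_maximum) auto
  moreover have "bdd_above {k. has_prime_chain ?L k}"
    by (rule bdd_aboveI[of _ n]) (simp add: le)
  ultimately show ?thesis
    unfolding has_krull_dimension_def by blast
qed

section \<open>The infinite tower\<close>

text \<open>Otherwise omega would be isomorphic to a proper initial segment of \<open>r\<close>, and
  these are finite.\<close>

lemma ordLeq_natLeq:
  assumes r: "Well_order r" and fin: "\<And>a. a \<in> Field r \<Longrightarrow> finite (underS r a)"
  shows "(r, natLeq) \<in> ordLeq"
proof (rule ccontr)
  assume "(r, natLeq) \<notin> ordLeq"
  then have "(natLeq, r) \<in> ordLess"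
    using r natLeq_Well_order by (simp add: not_ordLeq_iff_ordLess)
  then obtain a where a: "a \<in> Field r" "(natLeq, Restr r (underS r a)) \<in> ordIso"
    using ordLess_iff_ordIso_Restr[OF r natLeq_Well_order] by blast
  have "Field (Restr r (underS r a)) \<subseteq> underS r a"
    by (auto simp: Field_def)
  then have "finite (Field (Restr r (underS r a)))"
    using fin[OF a(1)] finite_subset by blast
  moreover obtain f where "BNF_Wellorder_Embedding.iso natLeq (Restr r (underS r a)) f"
    using a(2) by (auto simp: ordIso_def)
  then have "bij_betw f (UNIV :: nat set) (Field (Restr r (underS r a)))"
    by (simp add: BNF_Wellorder_Embedding.iso_def Field_natLeq)
  ultimately show False
    using bij_betw_finite infinite_UNIV_nat by blast
qed

lemma has_infinite_krull_dimension_tower: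
  "has_infinite_krull_dimension
    (leavitt_path_algebra (tower UNIV) :: (nat, nat, 'k::field) ncpoly set ring) natLeq"
proof -
  interpret tower_algebra UNIV "TYPE('k)"
    by unfold_locales auto
  let ?L = "leavitt_path_algebra E :: (nat, nat, 'k) ncpoly set ring"
  have sub: "tower_prime i \<subseteq> tower_prime j \<longleftrightarrow> i \<le> j" for i j
    by (simp add: tower_prime_subset_iff)
  have psub: "tower_prime i \<subset> tower_prime j \<longleftrightarrow> i < j" for i j
    by (simp add: tower_prime_psubset_iff)
  have prime: "prime_ideal P ?L \<longleftrightarrow> P \<in> range tower_prime" for P
    by (auto simp: prime_ideal_tower_iff)
  have upper: "(inclusion_on C, natLeq) \<in> ordLeq" if C: "continuous_prime_chain ?L C" for C
  proof (rule ordLeq_natLeq)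
    show "Well_order (inclusion_on C)"
      using C by (simp add: continuous_prime_chain_def)
    have mem: "P \<in> range tower_prime" if "P \<in> C" for P
      using C that prime by (simp add: continuous_prime_chain_def)
    fix P assume "P \<in> Field (inclusion_on C)"
    then have "P \<in> C" by (auto simp: inclusion_on_def Field_def)
    then obtain k where k: "P = tower_prime k"
      using mem by blast
    have "underS (inclusion_on C) P \<subseteq> tower_prime ` {..<k}"
    proof
      fix R assume R: "R \<in> underS (inclusion_on C) P"
      then have "R \<in> C" "R \<subset> P" by (auto simp: underS_def inclusion_on_def)
      moreover from this obtain j where "R = tower_prime j"
        using mem by blast
      ultimately show "R \<in> tower_prime ` {..<k}"
        using k psub by auto
    qed
    then show "finite (underS (inclusion_on C) P)"
      using finite_subset by blast
  qed
  \<comment> \<open>The set of all primes is itself an admissible chain of type omega: it attains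
    the supremum, so every upper bound \<open>r'\<close> is at least omega.\<close>
  let ?C = "range tower_prime"
  have image: "inclusion_on ?C = dir_image natLeq tower_prime"
    using sub by (auto simp: inclusion_on_def dir_image_def natLeq_def)
  have inj: "inj_on tower_prime (Field natLeq)"
    using inj_on_tower_prime by (simp add: Field_natLeq)
  have wo: "Well_order (inclusion_on ?C)"
    unfolding image by (rule Well_order_dir_image[OF natLeq_Well_order inj])
  \<comment> \<open>Continuity holds vacuously: a prime with predecessors has an index
    \<open>k > 0\<close>, and nothing lies strictly between \<open>k - 1\<close> and
    \<open>k\<close>.\<close>
  have "\<not> limit_in ?C P" for P
  proof
    assume lim: "limit_in ?C P"
    then obtain k where k: "P = tower_prime k"
      by (auto simp: limit_in_def)
    have "\<exists>j. j < k" "\<forall>j. j < k \<longrightarrow> (\<exists>i. j < i \<and> i < k)"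
      using lim by (simp_all add: k limit_in_def psub)
    then obtain i where "k - 1 < i" "i < k"
      by (metis diff_less gr_implies_not0 less_one not_gr_zero)
    then show False by simp
  qed
  then have chain: "continuous_prime_chain ?L ?C"
    using wo prime by (auto simp: continuous_prime_chain_def)
  have "(natLeq, r') \<in> ordLeq" if "(inclusion_on ?C, r') \<in> ordLeq" for r' :: "nat rel"
    using dir_image_ordIso[OF natLeq_Well_order inj] that unfolding image
    by (rule ordIso_ordLeq_trans)
  then show ?thesis
    unfolding has_infinite_krull_dimension_def
    by (intro conjI allI impI upper natLeq_Well_order)
      (use chain in \<open>simp_all add: Field_natLeq\<close>)
qed

theorem mainTheorem12:
  shows "(\<forall>n :: nat. \<exists>E :: (nat, nat) pre_digraph. wf_digraph E \<and>
            has_krull_dimension (leavitt_path_algebra E :: (nat, nat, 'k::field) ncpoly set ring) n) \<and>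
         (\<exists>E :: (nat, nat) pre_digraph. wf_digraph E \<and>
            has_infinite_krull_dimension
              (leavitt_path_algebra E :: (nat, nat, 'k::field) ncpoly set ring) natLeq)"
proof (intro conjI allI)
  fix n
  show "\<exists>E :: (nat, nat) pre_digraph. wf_digraph E \<and>
      has_krull_dimension (leavitt_path_algebra E :: (nat, nat, 'k) ncpoly set ring) n"
    using wf_digraph_tower[of "{..n}"] has_krull_dimension_tower by auto
  show "\<exists>E :: (nat, nat) pre_digraph. wf_digraph E \<and>
      has_infinite_krull_dimension (leavitt_path_algebra E :: (nat, nat, 'k) ncpoly set ring) natLeq"
    using wf_digraph_tower[of UNIV] has_infinite_krull_dimension_tower by auto
qed

end
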